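(* Let $G$ be a discrete group and $\mathcal C$ a collection of subgroups of $G$ (closed under conjugation) that is closed under taking products. Let $X=X^\delta_{\mathcal C}$ be the Dwyer space for the normalizer decomposition of $G$ over $\mathcal C$. Then for every $P\in\mathcal C$, the fixed point set $X^P$ and the orbit space $C_G(P)\backslash X^P$ are contractible.
   Context: $\mathcal C$ is closed under taking products if whenever $P,Q\in\mathcal C$ and the set $PQ$ is a subgroup of $G$, then $PQ\in\mathcal C$. Regard $\mathcal C$ as a poset under inclusion, with $G$ acting by conjugation. The Dwyer space $X^\delta_{\mathcal C}$ is the $G$-space given by the nerve of the poset category whose objects are the nonempty finite chains $\sigma=(H_0<\dots<H_n)$ of subgroups in $\mathcal C$, with a unique morphism $\sigma\to\tau$ iff $\tau$ is a subchain of $\sigma$, with $G$ acting by conjugation. (It is isomorphic to the homotopy colimit, over the category of $G$-orbits of such chains, of the functor sending an orbit to itself as a $G$-set; its realization is $G$-homeomorphic to the realization $|\mathcal C|$ of the nerve of the poset $\mathcal C$.) Contractibility refers to geometric realizations. *)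

theory Defs
  imports "HOL-Homology.Simplices" "HOL-Algebra.Group_Action" "HOL-Analysis.Sum_Topology"
begin

section \<open>Simplicial sets and their geometric realization\<close>

text \<open>The morphisms \<open>[m] \<rightarrow> [n]\<close> of the simplex category, where \<open>[n] = {0,\<dots>,n}\<close>; they are
  taken extensional so that composition is \<^const>\<open>compose\<close>.\<close>

definition delta_maps :: "nat \<Rightarrow> nat \<Rightarrow> (nat \<Rightarrow> nat) set" where
  "delta_maps m n = {\<alpha> \<in> {..m} \<rightarrow>\<^sub>E {..n}. mono_on {..m} \<alpha>}"

text \<open>\<open>oper S m n \<alpha>\<close> is the structure map \<open>\<alpha>\<^sup>* : S\<^sub>n \<rightarrow> S\<^sub>m\<close> induced by \<open>\<alpha> : [m] \<rightarrow> [n]\<close>.\<close>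

record 'a sset =
  simplices :: "nat \<Rightarrow> 'a set"
  oper :: "nat \<Rightarrow> nat \<Rightarrow> (nat \<Rightarrow> nat) \<Rightarrow> 'a \<Rightarrow> 'a"

locale simplicial_set =
  fixes S :: "'a sset"
  assumes oper_closed:
      "\<alpha> \<in> delta_maps m n \<Longrightarrow> x \<in> simplices S n \<Longrightarrow> oper S m n \<alpha> x \<in> simplices S m"
    and oper_id: "x \<in> simplices S n \<Longrightarrow> oper S n n (\<lambda>i\<in>{..n}. i) x = x"
    and oper_compose:
      "\<alpha> \<in> delta_maps l m \<Longrightarrow> \<beta> \<in> delta_maps m n \<Longrightarrow> x \<in> simplices S n \<Longrightarrow>
        oper S l m \<alpha> (oper S m n \<beta> x) = oper S l n (compose {..l} \<beta> \<alpha>) x"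

definition quotient_topology :: "'a topology \<Rightarrow> ('a \<times> 'a) set \<Rightarrow> 'a set topology" where
  "quotient_topology X r =
     topology (\<lambda>U. U \<subseteq> topspace X // r \<and> openin X {x \<in> topspace X. r `` {x} \<in> U})"

lemma openin_quotient_topology:
  "openin (quotient_topology X r) U \<longleftrightarrow>
     U \<subseteq> topspace X // r \<and> openin X {x \<in> topspace X. r `` {x} \<in> U}"
proof -
  have 1: "{x \<in> topspace X. r `` {x} \<in> U \<inter> V} =
      {x \<in> topspace X. r `` {x} \<in> U} \<inter> {x \<in> topspace X. r `` {x} \<in> V}" for U V
    by auto
  have 2: "{x \<in> topspace X. r `` {x} \<in> \<Union>\<K>} = (\<Union>K\<in>\<K>. {x \<in> topspace X. r `` {x} \<in> K})" for \<K>
    by auto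
  have "istopology (\<lambda>U. U \<subseteq> topspace X // r \<and> openin X {x \<in> topspace X. r `` {x} \<in> U})"
    unfolding istopology_def 1 2 by blast
  then show ?thesis
    by (simp add: quotient_topology_def topology_inverse')
qed

lemma topspace_quotient_topology [simp]:
  "topspace (quotient_topology X r) = topspace X // r"
proof
  show "topspace (quotient_topology X r) \<subseteq> topspace X // r"
    using openin_quotient_topology openin_topspace by blast
  have "{x \<in> topspace X. r `` {x} \<in> topspace X // r} = topspace X"
    by (auto simp: quotient_def)
  then have "openin (quotient_topology X r) (topspace X // r)"
    by (simp add: openin_quotient_topology)
  then show "topspace X // r \<subseteq> topspace (quotient_topology X r)"
    by (rule openin_subset)
qed

lemma quotient_map_quotient_topology:
  "quotient_map X (quotient_topology X r) (\<lambda>x. r `` {x})"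
  unfolding quotient_map_def by (auto simp: openin_quotient_topology quotient_def)

text \<open>The affine map \<open>\<alpha>\<^sub>* : \<Delta>\<^sup>m \<rightarrow> \<Delta>\<^sup>n\<close> sending vertex \<open>i\<close> to vertex \<open>\<alpha> i\<close>.\<close>

definition simplex_push :: "nat \<Rightarrow> (nat \<Rightarrow> nat) \<Rightarrow> (nat \<Rightarrow> real) \<Rightarrow> nat \<Rightarrow> real" where
  "simplex_push m \<alpha> t = (\<lambda>j. \<Sum>i | i \<le> m \<and> \<alpha> i = j. t i)"

lemma simplex_push_standard_simplex:
  assumes "\<alpha> \<in> delta_maps m n" and t: "t \<in> standard_simplex m"
  shows "simplex_push m \<alpha> t \<in> standard_simplex n"
proof -
  have \<alpha>: "\<alpha> i \<le> n" if "i \<le> m" for i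
    using assms(1) that by (auto simp: delta_maps_def PiE_iff)
  have t0: "0 \<le> t i" and t1: "(\<Sum>i\<le>m. t i) = 1" for i
    using t by (auto simp: standard_simplex_def)
  have "(\<Sum>j\<le>n. simplex_push m \<alpha> t j) = (\<Sum>j\<le>n. \<Sum>i\<in>{i\<in>{..m}. \<alpha> i = j}. t i)"
    by (simp add: simplex_push_def)
  also have "\<dots> = (\<Sum>i\<le>m. t i)"
    by (rule sum.group) (use \<alpha> in auto)
  finally have "(\<Sum>j\<le>n. simplex_push m \<alpha> t j) = 1"
    using t1 by simp
  moreover have "simplex_push m \<alpha> t j \<le> (\<Sum>i\<le>m. t i)" for j
    unfolding simplex_push_def by (rule sum_mono2) (use t0 in auto)
  moreover have "simplex_push m \<alpha> t j = 0" if "j > n" for j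
    unfolding simplex_push_def by (rule sum.neutral) (use \<alpha> that in fastforce)
  moreover have "0 \<le> simplex_push m \<alpha> t j" for j
    unfolding simplex_push_def by (rule sum_nonneg) (use t0 in auto)
  ultimately show ?thesis
    using t1 by (auto simp: standard_simplex_def)
qed

text \<open>\<open>|S|\<close> is the quotient of the coproduct of the spaces \<open>S\<^sub>n \<times> \<Delta>\<^sup>n\<close>, with \<open>S\<^sub>n\<close> discrete, by the
  equivalence relation generated by \<open>(\<alpha>\<^sup>* x, t) \<sim> (x, \<alpha>\<^sub>* t)\<close>.\<close>

definition simplex_sum :: "'a sset \<Rightarrow> (nat \<times> 'a \<times> (nat \<Rightarrow> real)) topology" where
  "simplex_sum S =
     sum_topology (\<lambda>n. prod_topology (discrete_topology (simplices S n))
                         (subtopology (powertop_real UNIV) (standard_simplex n))) UNIV"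

definition glue :: "'a sset \<Rightarrow> ((nat \<times> 'a \<times> (nat \<Rightarrow> real)) \<times> (nat \<times> 'a \<times> (nat \<Rightarrow> real))) set" where
  "glue S = {((m, oper S m n \<alpha> x, t), (n, x, simplex_push m \<alpha> t)) | m n \<alpha> x t.
     \<alpha> \<in> delta_maps m n \<and> x \<in> simplices S n \<and> t \<in> standard_simplex m}"

definition realization :: "'a sset \<Rightarrow> (nat \<times> 'a \<times> (nat \<Rightarrow> real)) set topology" where
  "realization S = quotient_topology (simplex_sum S) ((glue S \<union> (glue S)\<inverse>)\<^sup>*)"

text \<open>The empty space satisfies \<^const>\<open>contractible_space\<close>, so it has to be excluded.\<close>

definition contractible_sset :: "'a sset \<Rightarrow> bool" where
  "contractible_sset S \<longleftrightarrow>
     topspace (realization S) \<noteq> {} \<and> contractible_space (realization S)"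

text \<open>The category with objects \<open>A\<close> and a unique morphism \<open>x \<rightarrow> y\<close> iff \<open>R x y\<close>; an \<open>n\<close>-simplex of its
  nerve is a functor from \<open>[n]\<close>, recorded as the list of its \<open>n + 1\<close> values on objects.\<close>

definition nerve :: "'a set \<Rightarrow> ('a \<Rightarrow> 'a \<Rightarrow> bool) \<Rightarrow> 'a list sset" where
  "nerve A R =
     \<lparr>simplices = (\<lambda>n. {xs. length xs = Suc n \<and> set xs \<subseteq> A \<and>
                              (\<forall>i j. i \<le> j \<and> j \<le> n \<longrightarrow> R (xs ! i) (xs ! j))}),
      oper = (\<lambda>m n \<alpha> xs. map (\<lambda>i. xs ! \<alpha> i) [0..<Suc m])\<rparr>"

lemma simplicial_set_nerve: "simplicial_set (nerve A R)"
proof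
  fix \<alpha> m n and xs :: "'a list"
  assume \<alpha>: "\<alpha> \<in> delta_maps m n" and xs: "xs \<in> simplices (nerve A R) n"
  have le: "\<alpha> i \<le> n" if "i \<le> m" for i
    using \<alpha> that by (auto simp: delta_maps_def PiE_iff)
  have mono: "\<alpha> i \<le> \<alpha> j" if "i \<le> j" "j \<le> m" for i j
    using \<alpha> that by (auto simp: delta_maps_def monotone_on_def)
  have "xs ! \<alpha> i \<in> A" if "i \<le> m" for i
    using xs le[OF that] by (auto simp: nerve_def subset_iff)
  then show "oper (nerve A R) m n \<alpha> xs \<in> simplices (nerve A R) m"
    using xs le mono by (auto simp: nerve_def nth_append less_Suc_eq_le simp del: upt_Suc)
next
  fix n and xs :: "'a list"
  assume "xs \<in> simplices (nerve A R) n"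
  then show "oper (nerve A R) n n (\<lambda>i\<in>{..n}. i) xs = xs"
    by (intro nth_equalityI) (auto simp: nerve_def simp del: upt_Suc)
next
  fix \<alpha> \<beta> l m n and xs :: "'a list"
  assume "\<alpha> \<in> delta_maps l m"
  then have "\<alpha> i < Suc m" if "i \<le> l" for i
    using that by (auto simp: delta_maps_def PiE_iff less_Suc_eq_le)
  then show "oper (nerve A R) l m \<alpha> (oper (nerve A R) m n \<beta> xs) =
      oper (nerve A R) l n (compose {..l} \<beta> \<alpha>) xs"
    by (auto simp: nerve_def compose_def simp del: upt_Suc)
qed


section \<open>Group actions on simplicial sets\<close>

locale simplicial_G_set = group G + simplicial_set S
  for G :: "('g, 'z) monoid_scheme" (structure) and S :: "'a sset" +
  fixes \<phi> :: "'g \<Rightarrow> 'a \<Rightarrow> 'a"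
  assumes act_closed: "g \<in> carrier G \<Longrightarrow> x \<in> simplices S n \<Longrightarrow> \<phi> g x \<in> simplices S n"
    and act_one: "x \<in> simplices S n \<Longrightarrow> \<phi> \<one> x = x"
    and act_mult: "g \<in> carrier G \<Longrightarrow> h \<in> carrier G \<Longrightarrow> x \<in> simplices S n \<Longrightarrow>
      \<phi> (g \<otimes> h) x = \<phi> g (\<phi> h x)"
    and act_oper: "g \<in> carrier G \<Longrightarrow> \<alpha> \<in> delta_maps m n \<Longrightarrow> x \<in> simplices S n \<Longrightarrow>
      oper S m n \<alpha> (\<phi> g x) = \<phi> g (oper S m n \<alpha> x)"

definition fixed_sset :: "'g set \<Rightarrow> ('g \<Rightarrow> 'a \<Rightarrow> 'a) \<Rightarrow> 'a sset \<Rightarrow> 'a sset" where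
  "fixed_sset P \<phi> S =
     \<lparr>simplices = (\<lambda>n. {x \<in> simplices S n. \<forall>g\<in>P. \<phi> g x = x}), oper = oper S\<rparr>"

definition orbit_sset ::
    "('g, 'z) monoid_scheme \<Rightarrow> ('g \<Rightarrow> 'a \<Rightarrow> 'a) \<Rightarrow> 'a sset \<Rightarrow> 'a set sset" where
  "orbit_sset K \<phi> S =
     \<lparr>simplices = (\<lambda>n. orbits K (simplices S n) \<phi>), oper = (\<lambda>m n \<alpha> X. oper S m n \<alpha> ` X)\<rparr>"

definition centralizer :: "('g, 'z) monoid_scheme \<Rightarrow> 'g set \<Rightarrow> 'g set" where
  "centralizer G P = {g \<in> carrier G. \<forall>p\<in>P. g \<otimes>\<^bsub>G\<^esub> p = p \<otimes>\<^bsub>G\<^esub> g}"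

context simplicial_G_set
begin

lemma simplicial_set_fixed_sset:
  assumes "P \<subseteq> carrier G"
  shows "simplicial_set (fixed_sset P \<phi> S)"
proof -
  have "\<phi> g (oper S m n \<alpha> x) = oper S m n \<alpha> x"
    if "\<alpha> \<in> delta_maps m n" "x \<in> simplices S n" "\<phi> g x = x" "g \<in> P" for g m n \<alpha> x
    using act_oper[of g \<alpha> m n x] that assms by auto
  then show ?thesis
    by unfold_locales (auto simp: fixed_sset_def oper_closed oper_id oper_compose)
qed

lemma oper_image_orbit:
  assumes "\<alpha> \<in> delta_maps m n" "x \<in> simplices S n"
  shows "oper S m n \<alpha> ` orbit G \<phi> x = orbit G \<phi> (oper S m n \<alpha> x)"
proof -
  have orb: "orbit G \<phi> y = (\<lambda>g. \<phi> g y) ` carrier G" for y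
    by (auto simp: orbit_def)
  show ?thesis
    unfolding orb image_image by (rule image_cong) (use act_oper assms in auto)
qed

lemma simplicial_set_orbit_sset: "simplicial_set (orbit_sset G \<phi> S)"
proof
  fix \<alpha> m n X
  assume "\<alpha> \<in> delta_maps m n" "X \<in> simplices (orbit_sset G \<phi> S) n"
  then show "oper (orbit_sset G \<phi> S) m n \<alpha> X \<in> simplices (orbit_sset G \<phi> S) m"
    using oper_image_orbit oper_closed by (fastforce simp: orbit_sset_def orbits_def)
next
  fix n X
  assume "X \<in> simplices (orbit_sset G \<phi> S) n"
  then have "X \<subseteq> simplices S n"
    using act_closed by (auto simp: orbit_sset_def orbits_def orbit_def)
  then have "oper S n n (\<lambda>i\<in>{..n}. i) ` X = id ` X"
    by (intro image_cong) (auto simp: oper_id subset_iff)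
  then show "oper (orbit_sset G \<phi> S) n n (\<lambda>i\<in>{..n}. i) X = X"
    by (simp add: orbit_sset_def)
next
  fix \<alpha> \<beta> l m n X
  assume \<alpha>\<beta>: "\<alpha> \<in> delta_maps l m" "\<beta> \<in> delta_maps m n"
    and "X \<in> simplices (orbit_sset G \<phi> S) n"
  then have "X \<subseteq> simplices S n"
    using act_closed by (auto simp: orbit_sset_def orbits_def orbit_def)
  then have "oper S l m \<alpha> ` oper S m n \<beta> ` X = oper S l n (compose {..l} \<beta> \<alpha>) ` X"
    unfolding image_image by (intro image_cong) (use oper_compose \<alpha>\<beta> in \<open>auto simp: subset_iff\<close>)
  then show "oper (orbit_sset G \<phi> S) l m \<alpha> (oper (orbit_sset G \<phi> S) m n \<beta> X) =
      oper (orbit_sset G \<phi> S) l n (compose {..l} \<beta> \<alpha>) X"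
    by (simp add: orbit_sset_def)
qed

lemma subgroup_centralizer:
  assumes P: "P \<subseteq> carrier G"
  shows "subgroup (centralizer G P) G"
proof
  show "centralizer G P \<subseteq> carrier G"
    by (auto simp: centralizer_def)
  show "\<one> \<in> centralizer G P"
    using P by (auto simp: centralizer_def)
next
  fix g h
  assume g: "g \<in> centralizer G P" and h: "h \<in> centralizer G P"
  have "g \<otimes> h \<otimes> p = p \<otimes> (g \<otimes> h)" if p: "p \<in> P" for p
  proof -
    have c: "g \<in> carrier G" "h \<in> carrier G" "p \<in> carrier G"
      using g h p P by (auto simp: centralizer_def)
    have "g \<otimes> h \<otimes> p = g \<otimes> (p \<otimes> h)"
      using c h p by (simp add: m_assoc centralizer_def)
    also have "\<dots> = (p \<otimes> g) \<otimes> h"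
      using c g p by (simp add: m_assoc[symmetric] centralizer_def)
    finally show ?thesis
      using c by (simp add: m_assoc)
  qed
  then show "g \<otimes> h \<in> centralizer G P"
    using g h by (auto simp: centralizer_def)
next
  fix g
  assume g: "g \<in> centralizer G P"
  have "inv g \<otimes> p = p \<otimes> inv g" if p: "p \<in> P" for p
  proof -
    have c: "g \<in> carrier G" "p \<in> carrier G" and gp: "g \<otimes> p = p \<otimes> g"
      using g p P by (auto simp: centralizer_def)
    have "p = inv g \<otimes> (p \<otimes> g)"
      using c by (simp add: gp[symmetric] m_assoc[symmetric])
    then have "p \<otimes> inv g = inv g \<otimes> (p \<otimes> g) \<otimes> inv g"
      by simp
    also have "\<dots> = inv g \<otimes> p"
      using c by (simp add: m_assoc)
    finally show ?thesis ..
  qed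
  then show "inv g \<in> centralizer G P"
    using g by (auto simp: centralizer_def)
qed

lemma simplicial_G_set_fixed_sset:
  assumes P: "P \<subseteq> carrier G"
  shows "simplicial_G_set (G\<lparr>carrier := centralizer G P\<rparr>) (fixed_sset P \<phi> S) \<phi>"
proof -
  interpret C: group "G\<lparr>carrier := centralizer G P\<rparr>"
    using P by (intro subgroup_imp_group subgroup_centralizer)
  interpret F: simplicial_set "fixed_sset P \<phi> S"
    using P by (rule simplicial_set_fixed_sset)
  have "\<phi> p (\<phi> g x) = \<phi> g x"
    if "g \<in> centralizer G P" "p \<in> P" "x \<in> simplices S n" "\<phi> p x = x" for g p x n
  proof -
    have "g \<in> carrier G" "p \<in> carrier G" "p \<otimes> g = g \<otimes> p"
      using that P by (auto simp: centralizer_def)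
    then show ?thesis
      using that act_mult[of p g x n] act_mult[of g p x n] by simp
  qed
  moreover have "g \<in> carrier G" if "g \<in> centralizer G P" for g
    using that by (simp add: centralizer_def)
  ultimately have "simplicial_G_set_axioms (G\<lparr>carrier := centralizer G P\<rparr>) (fixed_sset P \<phi> S) \<phi>"
    by (intro simplicial_G_set_axioms.intro)
      (auto simp: fixed_sset_def act_closed act_one act_mult act_oper)
  then show ?thesis
    by (intro simplicial_G_set.intro C.is_group F.simplicial_set_axioms)
qed

end


section \<open>The Dwyer space of the normalizer decomposition\<close>

definition conjugate :: "('g, 'z) monoid_scheme \<Rightarrow> 'g \<Rightarrow> 'g set \<Rightarrow> 'g set" where
  "conjugate G g H = g <#\<^bsub>G\<^esub> H #>\<^bsub>G\<^esub> inv\<^bsub>G\<^esub> g"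

definition collection :: "('g, 'z) monoid_scheme \<Rightarrow> 'g set set \<Rightarrow> bool" where
  "collection G \<C> \<longleftrightarrow>
     (\<forall>H\<in>\<C>. subgroup H G) \<and> (\<forall>g\<in>carrier G. \<forall>H\<in>\<C>. conjugate G g H \<in> \<C>)"

definition closed_under_products :: "('g, 'z) monoid_scheme \<Rightarrow> 'g set set \<Rightarrow> bool" where
  "closed_under_products G \<C> \<longleftrightarrow>
     (\<forall>P\<in>\<C>. \<forall>Q\<in>\<C>. subgroup (P <#>\<^bsub>G\<^esub> Q) G \<longrightarrow> P <#>\<^bsub>G\<^esub> Q \<in> \<C>)"

text \<open>A chain \<open>H\<^sub>0 < \<dots> < H\<^sub>n\<close> is represented by the set \<open>{H\<^sub>0,\<dots>,H\<^sub>n}\<close>, so that subchains are subsets.\<close>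

definition subgroup_chains :: "'g set set \<Rightarrow> 'g set set set" where
  "subgroup_chains \<C> = {\<sigma>. \<sigma> \<subseteq> \<C> \<and> finite \<sigma> \<and> \<sigma> \<noteq> {} \<and> chain\<^sub>\<subseteq> \<sigma>}"

definition dwyer_space :: "'g set set \<Rightarrow> 'g set set list sset" where
  "dwyer_space \<C> = nerve (subgroup_chains \<C>) (\<lambda>\<sigma> \<tau>. \<tau> \<subseteq> \<sigma>)"

definition dwyer_action ::
    "('g, 'z) monoid_scheme \<Rightarrow> 'g \<Rightarrow> 'g set set list \<Rightarrow> 'g set set list" where
  "dwyer_action G g = map (image (conjugate G g))"

lemma simplicial_G_set_dwyer_space:
  assumes "group G" and \<C>: "collection G \<C>"
  shows "simplicial_G_set G (dwyer_space \<C>) (dwyer_action G)"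
proof -
  interpret group G by fact
  interpret S: simplicial_set "dwyer_space \<C>"
    unfolding dwyer_space_def by (rule simplicial_set_nerve)
  have sub: "H \<subseteq> carrier G" if "H \<in> \<C>" for H
    using \<C> that by (auto simp: collection_def subgroup.subset)
  have conj: "conjugate G g H = (\<lambda>h. g \<otimes>\<^bsub>G\<^esub> h \<otimes>\<^bsub>G\<^esub> inv\<^bsub>G\<^esub> g) ` H" for g H
    unfolding conjugate_def l_coset_def r_coset_def by blast
  have one: "conjugate G \<one>\<^bsub>G\<^esub> H = H" if "H \<in> \<C>" for H
  proof -
    have "conjugate G \<one>\<^bsub>G\<^esub> H = id ` H"
      unfolding conj by (rule image_cong) (use sub[OF that] in auto)
    then show ?thesis
      by simp
  qed
  have mult: "conjugate G (g \<otimes>\<^bsub>G\<^esub> h) H = conjugate G g (conjugate G h H)"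
    if "g \<in> carrier G" "h \<in> carrier G" "H \<in> \<C>" for g h H
    unfolding conj image_image
    by (rule image_cong)
      (use that(1,2) sub[OF that(3)] in \<open>auto simp: m_assoc inv_mult_group subset_iff\<close>)
  have chain: "conjugate G g ` \<sigma> \<in> subgroup_chains \<C>"
    if "g \<in> carrier G" "\<sigma> \<in> subgroup_chains \<C>" for g \<sigma>
  proof -
    have "chain\<^sub>\<subseteq> (conjugate G g ` \<sigma>)"
      using that(2) unfolding subgroup_chains_def chain_subset_def conj
      by (simp add: image_iff) (meson image_mono)
    then show ?thesis
      using that \<C> by (auto simp: subgroup_chains_def collection_def)
  qed
  have im1: "image (conjugate G \<one>\<^bsub>G\<^esub>) \<sigma> = \<sigma>" if "\<sigma> \<in> subgroup_chains \<C>" for \<sigma>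
  proof -
    have "image (conjugate G \<one>\<^bsub>G\<^esub>) \<sigma> = id ` \<sigma>"
      by (rule image_cong) (use that one in \<open>auto simp: subgroup_chains_def\<close>)
    then show ?thesis
      by simp
  qed
  have im2: "image (conjugate G (g \<otimes>\<^bsub>G\<^esub> h)) \<sigma> = image (conjugate G g) (image (conjugate G h) \<sigma>)"
    if "g \<in> carrier G" "h \<in> carrier G" "\<sigma> \<in> subgroup_chains \<C>" for g h \<sigma>
    unfolding image_image by (rule image_cong) (use that mult in \<open>auto simp: subgroup_chains_def\<close>)
  have "simplicial_G_set_axioms G (dwyer_space \<C>) (dwyer_action G)"
  proof
    fix g x n
    assume g: "g \<in> carrier G" and x: "x \<in> simplices (dwyer_space \<C>) n"
    then have "\<forall>\<sigma>\<in>set x. conjugate G g ` \<sigma> \<in> subgroup_chains \<C>"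
      using chain by (auto simp: dwyer_space_def nerve_def)
    then show "dwyer_action G g x \<in> simplices (dwyer_space \<C>) n"
      using x by (auto simp: dwyer_space_def dwyer_action_def nerve_def image_mono)
  next
    fix x n
    assume "x \<in> simplices (dwyer_space \<C>) n"
    then have "image (conjugate G \<one>\<^bsub>G\<^esub>) \<sigma> = \<sigma>" if "\<sigma> \<in> set x" for \<sigma>
      using im1 that by (auto simp: dwyer_space_def nerve_def)
    then show "dwyer_action G \<one>\<^bsub>G\<^esub> x = x"
      unfolding dwyer_action_def by (rule map_idI)
  next
    fix g h x n
    assume "g \<in> carrier G" "h \<in> carrier G" "x \<in> simplices (dwyer_space \<C>) n"
    then have "image (conjugate G (g \<otimes>\<^bsub>G\<^esub> h)) \<sigma> = image (conjugate G g) (image (conjugate G h) \<sigma>)"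
      if "\<sigma> \<in> set x" for \<sigma>
      by (intro im2) (use that in \<open>auto simp: dwyer_space_def nerve_def\<close>)
    then show "dwyer_action G (g \<otimes>\<^bsub>G\<^esub> h) x = dwyer_action G g (dwyer_action G h x)"
      by (simp add: dwyer_action_def)
  next
    fix g \<alpha> m n x
    assume "\<alpha> \<in> delta_maps m n" and "x \<in> simplices (dwyer_space \<C>) n"
    then show "oper (dwyer_space \<C>) m n \<alpha> (dwyer_action G g x) =
        dwyer_action G g (oper (dwyer_space \<C>) m n \<alpha> x)"
      by (auto simp: dwyer_space_def dwyer_action_def nerve_def delta_maps_def PiE_iff
          less_Suc_eq_le simp del: upt_Suc)
  qed
  then show ?thesis
    by (intro simplicial_G_set.intro is_group S.simplicial_set_axioms)
qed

end

theory Submission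
  imports Defs "HOL-Analysis.Abstract_Topological_Spaces"
begin

text \<open>A chain in \<open>\<C>\<close> fixed by \<open>P\<close> consists of subgroups normalized by \<open>P\<close>, so \<open>X\<^sup>P\<close> is the subdivision of
  the nerve of the poset \<open>A\<close> of these subgroups. The maps \<open>H \<subseteq> PH \<supseteq> P\<close> contract \<open>A\<close>, and they commute
  with \<open>C\<^sub>G(P)\<close>. The contraction is carried out on weights, the barycentric coordinates of points of
  the realization, so that it descends to the orbit space: a point of the realization of a
  quotient of a nerve depends only on the weight of a representative. A weight \<open>c\<close> on chains of \<open>A\<close>
  becomes the function \<open>\<Sum>\<sigma>. c \<sigma> \<cdot> 1\<^sub>\<sigma>\<close> on \<open>A\<close>; its mass is moved from \<open>H\<close> to \<open>PH\<close>, from the top of the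
  chain downwards, and then linearly to \<open>P\<close>; the superlevel sets of the result give back a weight
  on chains.\<close>

section \<open>Weights and quotients of nerves\<close>

text \<open>A simplex of the orbit space is an orbit of a whole list of chains, which the orbits of
  its entries need not determine. So the orbit space need not be the nerve of a poset, and
  homotopies between order maps do not apply to it directly; a homotopy of points is needed that
  commutes strictly with conjugation. The straight line from a function on A to its pushforward
  along H |-> PH leaves the functions supported on chains: for H < K the subgroups PH and K may be
  incomparable. Moving the top first avoids this, since a staying H and a moved K satisfy H \<le> K
  \<le> PK. In coordinates this is the prism decomposition of a simplex times an interval. Once all
  mass lies above P, straight lines to P are harmless. Passing to A does not preserve the total: a
  chain of k subgroups counts k times. Hence intermediate functions are only required to be nonzero,
  and division by the total comes last. The realization has the quotient topology, so continuity is
  tested one simplex at a time, where only finitely many subgroups are involved.\<close>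

definition comparable :: "'a::order set \<Rightarrow> bool" where
  "comparable E \<longleftrightarrow> (\<forall>x\<in>E. \<forall>y\<in>E. x \<le> y \<or> y \<le> x)"

definition supp :: "('a \<Rightarrow> real) \<Rightarrow> 'a set" where
  "supp c = {a. c a \<noteq> 0}"

definition weights :: "'a::order set \<Rightarrow> ('a \<Rightarrow> real) set" where
  "weights D = {c. finite (supp c) \<and> supp c \<subseteq> D \<and> comparable (supp c) \<and>
                   (\<forall>a. 0 \<le> c a) \<and> sum c (supp c) = 1}"

text \<open>Repeated vertices are collected, so a degenerate simplex and the nondegenerate one
  beneath it yield the same function. Indexing by vertices instead of positions is what survives the
  gluing.\<close>

definition coord :: "'d list \<Rightarrow> (nat \<Rightarrow> real) \<Rightarrow> 'd \<Rightarrow> real" where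
  "coord x t d = (\<Sum>i | i < length x \<and> x ! i = d. t i)"

lemma comparable_subset: "comparable E \<Longrightarrow> F \<subseteq> E \<Longrightarrow> comparable F"
  by (auto simp: comparable_def)

lemma comparable_sorted_list:
  assumes "finite E" "comparable E"
  shows "\<exists>x. distinct x \<and> set x = E \<and> sorted_wrt (\<lambda>a b. b \<le> a) x"
  using assms
proof (induction E rule: finite_psubset_induct)
  case (psubset E)
  show ?case
  proof (cases "E = {}")
    case False
    then obtain m where m: "m \<in> E" "\<And>a. a \<in> E \<Longrightarrow> a \<le> m \<Longrightarrow> a = m"
      using finite_has_minimal[OF \<open>finite E\<close>] by metis
    then have le: "m \<le> a" if "a \<in> E" for a
      using psubset.prems that by (auto simp: comparable_def)
    have "\<exists>x. distinct x \<and> set x = E - {m} \<and> sorted_wrt (\<lambda>a b. b \<le> a) x"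
      using m(1) psubset.prems by (intro psubset.IH) (auto intro: comparable_subset)
    then obtain x where "distinct x" "set x = E - {m}" "sorted_wrt (\<lambda>a b. b \<le> a) x"
      by blast
    then have "distinct (x @ [m]) \<and> set (x @ [m]) = E \<and> sorted_wrt (\<lambda>a b. b \<le> a) (x @ [m])"
      using m(1) le by (auto simp: sorted_wrt_append)
    then show ?thesis
      by blast
  qed simp
qed

text \<open>The lists decrease because in the category of chains a morphism \<sigma> \<rightarrow>
  \<tau> means that \<tau> is a subchain of \<sigma>.\<close>

lemma nerve_iff:
  "x \<in> simplices (nerve D (\<lambda>a b. b \<le> (a::'d::order))) n \<longleftrightarrow>
     length x = Suc n \<and> set x \<subseteq> D \<and> sorted_wrt (\<lambda>a b. b \<le> a) x"
proof -
  have "(\<forall>i j. i \<le> j \<and> j \<le> n \<longrightarrow> x ! j \<le> x ! i) \<longleftrightarrow> sorted_wrt (\<lambda>a b. b \<le> a) x"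
    if "length x = Suc n"
    unfolding sorted_wrt_iff_nth_less that less_Suc_eq_le
    by (metis le_less order_refl)
  then show ?thesis
    by (auto simp: nerve_def)
qed

lemma sorted_wrt_comparable: "sorted_wrt (\<lambda>a b. b \<le> a) x \<Longrightarrow> comparable (set x)"
  by (induction x) (auto simp: comparable_def)

lemma coord_eq_0: "d \<notin> set x \<Longrightarrow> coord x t d = 0"
  unfolding coord_def by (rule sum.neutral) auto

lemma sum_coord:
  assumes "finite E" "set x \<subseteq> E"
  shows "sum (coord x t) E = (\<Sum>i<length x. t i)"
proof -
  have "(\<Sum>d\<in>E. sum t {i \<in> {..<length x}. x ! i = d}) = sum t {..<length x}"
    using assms by (intro sum.group) auto
  then show ?thesis
    by (simp add: coord_def)
qed

lemma coord_weights:
  assumes x: "x \<in> simplices (nerve D (\<lambda>a b. b \<le> (a::'d::order))) n" and t: "t \<in> standard_simplex n"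
  shows "coord x t \<in> weights D" "supp (coord x t) \<subseteq> set x"
proof -
  show s: "supp (coord x t) \<subseteq> set x"
    using coord_eq_0 by (fastforce simp: supp_def)
  have "sum (coord x t) (supp (coord x t)) = sum (coord x t) (set x)"
    by (rule sum.mono_neutral_left) (use s in \<open>auto simp: supp_def\<close>)
  also have "\<dots> = 1"
    using x t by (simp add: sum_coord nerve_iff standard_simplex_def lessThan_Suc_atMost)
  finally have "sum (coord x t) (supp (coord x t)) = 1" .
  moreover have "0 \<le> coord x t a" for a
    unfolding coord_def by (rule sum_nonneg) (use t in \<open>auto simp: standard_simplex_def\<close>)
  moreover have x': "set x \<subseteq> D" "sorted_wrt (\<lambda>a b. b \<le> a) x"
    using x by (simp_all only: nerve_iff)
  moreover have "finite (supp (coord x t))" "comparable (supp (coord x t))"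
    using finite_subset[OF s] comparable_subset[OF sorted_wrt_comparable[OF x'(2)] s] by simp_all
  ultimately show "coord x t \<in> weights D"
    using s unfolding weights_def by blast
qed

text \<open>Both sides group the indices \<open>i \<le> m\<close> by the vertex
  \<open>x ! \<alpha> i\<close>, once directly and once through the fibres of
  \<open>\<alpha>\<close>. This is why the weight of a point is unchanged by gluing.\<close>

lemma coord_oper:
  assumes "\<alpha> \<in> delta_maps m n" "length x = Suc n"
  shows "coord (map (\<lambda>i. x ! \<alpha> i) [0..<Suc m]) t = coord x (simplex_push m \<alpha> t)"
proof
  fix d
  define A where "A = {i. i \<le> m \<and> x ! \<alpha> i = d}"
  define B where "B = {j. j < Suc n \<and> x ! j = d}"
  have "(\<Sum>j\<in>B. sum t {i \<in> A. \<alpha> i = j}) = sum t A"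
    by (rule sum.group) (use assms in \<open>auto simp: A_def B_def delta_maps_def PiE_iff less_Suc_eq_le\<close>)
  moreover have "simplex_push m \<alpha> t j = sum t {i \<in> A. \<alpha> i = j}" if "j \<in> B" for j
    unfolding simplex_push_def by (rule sum.cong) (use that in \<open>auto simp: A_def B_def\<close>)
  moreover have "{i. i < Suc m \<and> map (\<lambda>i. x ! \<alpha> i) [0..<Suc m] ! i = d} = A"
    by (auto simp: A_def less_Suc_eq_le simp del: upt_Suc)
  ultimately show "coord (map (\<lambda>i. x ! \<alpha> i) [0..<Suc m]) t d = coord x (simplex_push m \<alpha> t) d"
    using assms(2) by (simp add: coord_def B_def del: upt_Suc)
qed

lemma coord_map:
  assumes "inj_on g D" "set x \<subseteq> D" "d \<in> D"
  shows "coord (map g x) t (g d) = coord x t d"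
  unfolding coord_def
  by (rule sum.cong) (use assms nth_mem in \<open>auto simp: inj_on_eq_iff subset_iff\<close>)

lemma coord_distinct:
  assumes "distinct x" "j < length x"
  shows "coord x t (x ! j) = t j"
proof -
  have "{i. i < length x \<and> x ! i = x ! j} = {j}"
    using assms by (auto simp: nth_eq_iff_index_eq)
  then show ?thesis
    by (simp add: coord_def)
qed

text \<open>The dimension is only bounded below, so that all weights on a finite set can be realized
  in one common dimension.\<close>

lemma weights_coord:
  assumes c: "c \<in> weights D" and n: "card (supp c) \<le> Suc n"
  shows "\<exists>x\<in>simplices (nerve D (\<lambda>a b. b \<le> (a::'d::order))) n. \<exists>t\<in>standard_simplex n.
           set x = supp c \<and> coord x t = c"
proof -
  obtain y where y: "distinct y" "set y = supp c" "sorted_wrt (\<lambda>a b. b \<le> a) y"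
    using c comparable_sorted_list[of "supp c"] by (auto simp: weights_def)
  have "supp c \<noteq> {}"
    using c by (auto simp: weights_def)
  then have "y \<noteq> []"
    using y(2) by auto
  \<comment> \<open>Padding repeats the least vertex, which keeps the list decreasing.\<close>
  define x where "x = y @ replicate (Suc n - length y) (last y)"
  have "b \<ge> last y" if "b \<in> set y" for b
    using y(3) \<open>y \<noteq> []\<close> that
    by (cases y rule: rev_cases) (auto simp: sorted_wrt_append)
  moreover have "sorted_wrt (\<lambda>a b. b \<le> a) (replicate k b)" for k and b :: 'd
    by (induction k) auto
  ultimately have sx: "sorted_wrt (\<lambda>a b. b \<le> a) x"
    using y(3) by (simp add: x_def sorted_wrt_append)
  have "length y \<le> Suc n"
    using n y distinct_card by fastforce
  then have len: "length x = Suc n"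
    by (simp add: x_def)
  have sx2: "set x = supp c"
    using last_in_set[OF \<open>y \<noteq> []\<close>]
    by (simp add: x_def y(2)[symmetric] set_replicate_conv_if insert_absorb)
  have xN: "x \<in> simplices (nerve D (\<lambda>a b. b \<le> a)) n"
    using c sx len sx2 by (simp only: nerve_iff weights_def mem_Collect_eq)
  \<comment> \<open>Each vertex shares its weight equally among its repetitions.\<close>
  define t where "t i = (if i \<le> n then c (x ! i) / card {j. j < Suc n \<and> x ! j = x ! i} else 0)" for i
  have xt: "coord x t = c"
  proof
    fix d
    show "coord x t d = c d"
    proof (cases "d \<in> set x")
      case True
      let ?I = "{j. j < Suc n \<and> x ! j = d}"
      have "?I \<noteq> {}"
        using True len by (auto simp: in_set_conv_nth)
      then have "card ?I \<noteq> 0"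
        by simp
      moreover have "coord x t d = (\<Sum>i\<in>?I. c d / card ?I)"
        unfolding coord_def len by (rule sum.cong) (auto simp: t_def)
      ultimately show ?thesis
        by simp
    next
      case False
      then show ?thesis
        using sx2 by (auto simp: coord_eq_0 supp_def)
    qed
  qed
  have t0: "0 \<le> t i" for i
    using c by (auto simp: t_def weights_def)
  have "(\<Sum>i<Suc n. t i) = sum c (supp c)"
    using sum_coord[of "set x" x t] xt len sx2 by (metis finite_set order_refl)
  then have t1: "(\<Sum>i\<le>n. t i) = 1"
    using c by (simp add: weights_def lessThan_Suc_atMost)
  have "t i \<le> 1" for i
  proof (cases "i \<le> n")
    case True
    then have "t i \<le> (\<Sum>i\<le>n. t i)"
      by (intro member_le_sum) (use t0 in auto)
    then show ?thesis
      using t1 by simp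
  qed (simp add: t_def)
  then have "t \<in> standard_simplex n"
    using t0 t1 by (auto simp: standard_simplex_def t_def)
  then show ?thesis
    using xN xt sx2 by blast
qed

text \<open>This isolates what the fixed points (\<open>\<pi>\<close> the identity) and the orbit
  space (\<open>\<pi>\<close> the orbit map) have in common. In \<open>proj_eqD\<close> a single
  \<open>g\<close> moves all entries of the list, as for orbits of an entrywise action.\<close>

locale nerve_quotient =
  fixes D :: "'d::order set" and S :: "'s sset" and \<pi> :: "'d list \<Rightarrow> 's"
    and \<Gamma> :: "('d \<Rightarrow> 'd) set" and N :: "nat \<Rightarrow> 'd list set"
  defines "N \<equiv> simplices (nerve D (\<lambda>a b. b \<le> a))"
  assumes simplices_eq: "simplices S n = \<pi> ` N n"
    and oper_eq: "\<alpha> \<in> delta_maps m n \<Longrightarrow> x \<in> N n \<Longrightarrow>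
      oper S m n \<alpha> (\<pi> x) = \<pi> (map (\<lambda>i. x ! \<alpha> i) [0..<Suc m])"
    and proj_eqD: "x \<in> N n \<Longrightarrow> y \<in> N n \<Longrightarrow> \<pi> x = \<pi> y \<Longrightarrow> \<exists>g\<in>\<Gamma>. y = map g x"
    and proj_map: "g \<in> \<Gamma> \<Longrightarrow> x \<in> N n \<Longrightarrow> map g x \<in> N n \<and> \<pi> (map g x) = \<pi> x"
    and bij_Gamma: "g \<in> \<Gamma> \<Longrightarrow> bij_betw g D D"
begin

lemma N_iff: "x \<in> N n \<longleftrightarrow> length x = Suc n \<and> set x \<subseteq> D \<and> sorted_wrt (\<lambda>a b. b \<le> a) x"
  unfolding N_def by (rule nerve_iff)

lemma oper_N: "\<alpha> \<in> delta_maps m n \<Longrightarrow> x \<in> N n \<Longrightarrow> map (\<lambda>i. x ! \<alpha> i) [0..<Suc m] \<in> N m"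
  using simplicial_set.oper_closed[OF simplicial_set_nerve[of D "\<lambda>a b. b \<le> a"]]
  by (simp add: N_def nerve_def del: upt_Suc)

section \<open>Gluing classes and the weights that determine them\<close>

definition rel where "rel = (glue S \<union> (glue S)\<inverse>)\<^sup>*"

definition cls where "cls p = rel `` {p}"

lemma cls_eq_iff: "cls p = cls q \<longleftrightarrow> (p, q) \<in> rel"
proof -
  have "sym rel" "trans rel" "refl rel"
    by (auto simp: rel_def sym_Un_converse sym_rtrancl trans_rtrancl refl_rtrancl)
  then have "equiv UNIV rel"
    by (simp add: equiv_def)
  then show ?thesis
    by (simp add: cls_def eq_equiv_class_iff)
qed

lemma cls_glue: "(p, q) \<in> glue S \<Longrightarrow> cls p = cls q"
  unfolding cls_eq_iff by (auto simp: rel_def)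

text \<open>If all vertices of \<open>x\<close> occur in the nondegenerate \<open>y\<close>, then
  \<open>x\<close> arises from \<open>y\<close> by a map \<open>\<beta>\<close> of the simplex
  category, and one gluing step suffices.\<close>

lemma cls_index:
  assumes y: "y \<in> N m" "distinct y" and x: "x \<in> N n" "set x \<subseteq> set y"
    and t: "t \<in> standard_simplex n"
  shows "cls (n, \<pi> x, t) = cls (m, \<pi> y, \<lambda>j. if j \<le> m then coord x t (y ! j) else 0)"
proof -
  have "\<exists>j\<le>m. y ! j = x ! i" if "i \<le> n" for i
  proof -
    have "x ! i \<in> set y"
      using x that by (auto simp: N_iff)
    then show ?thesis
      using y by (auto simp: N_iff in_set_conv_nth less_Suc_eq_le)
  qed
  then obtain b where b: "\<And>i. i \<le> n \<Longrightarrow> b i \<le> m \<and> y ! b i = x ! i"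
    by metis
  define \<beta> where "\<beta> = (\<lambda>i\<in>{..n}. b i)"
  have \<beta>: "\<beta> i \<le> m" "y ! \<beta> i = x ! i" if "i \<le> n" for i
    using b that by (auto simp: \<beta>_def)
  \<comment> \<open>Both lists decrease, so a descent of \<open>\<beta>\<close> would make two
    entries of \<open>y\<close> equal, against distinctness.\<close>
  have "\<beta> i \<le> \<beta> j" if "i \<le> j" "j \<le> n" for i j
  proof (rule ccontr)
    assume neg: "\<not> \<beta> i \<le> \<beta> j"
    have "y ! \<beta> i \<le> y ! \<beta> j"
      using neg y(1) \<beta>(1)[of i] that by (auto simp: N_iff sorted_wrt_iff_nth_less)
    moreover have "x ! j \<le> x ! i"
      using x(1) that by (cases "i = j") (auto simp: N_iff sorted_wrt_iff_nth_less)
    ultimately have "y ! \<beta> i = y ! \<beta> j"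
      using \<beta>(2)[of i] \<beta>(2)[of j] that by simp
    then have "\<beta> i = \<beta> j"
      using y \<beta>(1)[of i] \<beta>(1)[of j] that by (simp add: N_iff nth_eq_iff_index_eq)
    with neg show False
      by simp
  qed
  then have delta: "\<beta> \<in> delta_maps n m"
    using \<beta>(1) by (auto simp: delta_maps_def \<beta>_def monotone_on_def PiE_iff)
  have x_eq: "map (\<lambda>i. y ! \<beta> i) [0..<Suc n] = x"
    using x(1) \<beta>(2) by (intro nth_equalityI) (auto simp: N_iff less_Suc_eq_le simp del: upt_Suc)
  \<comment> \<open>As \<open>y\<close> is distinct, its coordinates can be read off from the
    weight, and \<open>coord_oper\<close> says that the weight is that of \<open>x\<close>.\<close>
  have push: "simplex_push n \<beta> t = (\<lambda>j. if j \<le> m then coord x t (y ! j) else 0)"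
  proof
    fix j
    show "simplex_push n \<beta> t j = (if j \<le> m then coord x t (y ! j) else 0)"
    proof (cases "j \<le> m")
      case True
      then have "coord x t (y ! j) = simplex_push n \<beta> t j"
        using y coord_oper[OF delta, of y t] coord_distinct[of y j]
        by (simp add: N_iff x_eq del: upt_Suc)
      with True show ?thesis
        by simp
    next
      case False
      then show ?thesis
        using simplex_push_standard_simplex[OF delta t] by (simp add: standard_simplex_def)
    qed
  qed
  have "((n, oper S n m \<beta> (\<pi> y), t), (m, \<pi> y, simplex_push n \<beta> t)) \<in> glue S"
    using delta y(1) t simplices_eq unfolding glue_def by blast
  then show ?thesis
    using cls_glue oper_eq[OF delta y(1)] unfolding x_eq push by metis
qed

text \<open>Both simplices are compared with the nondegenerate simplex on the support of their common
  weight.\<close>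

lemma cls_coord:
  assumes "x \<in> N n" "t \<in> standard_simplex n" "x' \<in> N n'" "t' \<in> standard_simplex n'"
    and eq: "coord x t = coord x' t'"
  shows "cls (n, \<pi> x, t) = cls (n', \<pi> x', t')"
proof -
  define c where "c = coord x t"
  have c: "c \<in> weights D"
    using assms(1,2) coord_weights by (auto simp: c_def N_def)
  obtain k where k: "card (supp c) = Suc k"
    using c by (cases "card (supp c)") (auto simp: weights_def)
  obtain y u where y: "y \<in> N k" "set y = supp c" and u: "u \<in> standard_simplex k" and yu: "coord y u = c"
    using weights_coord[OF c, of k] k by (auto simp: N_def)
  have main: "cls (m, \<pi> z, v) = cls (k, \<pi> y, u)"
    if z: "z \<in> N m" and v: "v \<in> standard_simplex m" and zv: "coord z v = c" for m z v
  proof -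
    \<comment> \<open>\<open>z\<close> may repeat vertices and may have vertices of coordinate 0.
      The nondegenerate \<open>z'\<close> on all its vertices contains those of both
      \<open>z\<close> and \<open>y\<close>, so \<open>cls_index\<close> applies to each.\<close>
    obtain z' where z': "distinct z'" "set z' = set z" "sorted_wrt (\<lambda>a b. b \<le> a) z'"
      using comparable_sorted_list[of "set z"] sorted_wrt_comparable z by (auto simp: N_iff)
    have "z \<noteq> []"
      using z by (auto simp: N_iff)
    then obtain l where "length z' = Suc l"
      using z'(2) by (cases z') auto
    then have l: "z' \<in> N l"
      using z z' by (simp add: N_iff)
    have "set y \<subseteq> set z'"
      using coord_weights(2)[of z D m v] z v z'(2) y(2) zv by (auto simp: N_def)
    then have "cls (k, \<pi> y, u) = cls (l, \<pi> z', \<lambda>j. if j \<le> l then c (z' ! j) else 0)"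
      using cls_index[OF l z'(1) y(1) _ u] unfolding yu by blast
    then show ?thesis
      using cls_index[OF l z'(1) z _ v] unfolding zv z'(2) by simp
  qed
  show ?thesis
    using main[OF assms(1,2)] main[OF assms(3,4)] eq by (simp add: c_def)
qed

text \<open>By \<open>cls_coord\<close> the choice of a representing simplex is immaterial; on
  functions that are not weights the value is arbitrary.\<close>

definition point :: "('d \<Rightarrow> real) \<Rightarrow> (nat \<times> 's \<times> (nat \<Rightarrow> real)) set" where
  "point c = (SOME q. \<exists>n x t. x \<in> N n \<and> t \<in> standard_simplex n \<and> coord x t = c \<and> q = cls (n, \<pi> x, t))"

lemma point_coord:
  assumes "x \<in> N n" "t \<in> standard_simplex n"
  shows "point (coord x t) = cls (n, \<pi> x, t)"
  unfolding point_def by (rule some_equality) (use assms cls_coord in blast)+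

text \<open>Transport by \<open>g\<close> carries a representing simplex \<open>x\<close> to
  \<open>map g x\<close>, and \<open>\<pi>\<close> does not distinguish the two.\<close>

lemma point_invariant:
  assumes c: "c \<in> weights D" and c': "c' \<in> weights D" and g: "g \<in> \<Gamma>"
    and eq: "\<And>d. d \<in> D \<Longrightarrow> c' (g d) = c d"
  shows "point c' = point c"
proof -
  obtain x t where x: "x \<in> N (card (supp c))" and t: "t \<in> standard_simplex (card (supp c))"
    and xt: "coord x t = c"
    using weights_coord[OF c, of "card (supp c)"] by (auto simp: N_def)
  have gx: "map g x \<in> N (card (supp c))" "\<pi> (map g x) = \<pi> x"
    using proj_map[OF g x] by auto
  have bij: "bij_betw g D D"
    using g by (rule bij_Gamma)
  have "coord (map g x) t d = c' d" for d
  proof (cases "d \<in> D")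
    case True
    then obtain e where "e \<in> D" "d = g e"
      using bij by (auto simp: bij_betw_def)
    then show ?thesis
      using coord_map[of g D x e t] bij x xt eq by (auto simp: bij_betw_def N_iff)
  next
    case False
    moreover have "set (map g x) \<subseteq> D"
      using gx by (simp add: N_iff)
    ultimately have "coord (map g x) t d = 0"
      by (intro coord_eq_0) auto
    moreover have "c' d = 0"
      using False c' by (auto simp: weights_def supp_def)
    ultimately show ?thesis
      by simp
  qed
  then have "coord (map g x) t = c'"
    by blast
  then show ?thesis
    using point_coord[OF x t] point_coord[OF gx(1) t] gx(2) xt by simp
qed

end

section \<open>Continuity on coproducts of simplices and descent to the realization\<close>

lemma continuous_map_prod_discrete:
  assumes "\<And>x. x \<in> L \<Longrightarrow> continuous_map Z W (\<lambda>z. f (x, z))"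
  shows "continuous_map (prod_topology (discrete_topology L) Z) W f"
  unfolding continuous_map
proof (intro conjI allI impI)
  show "f ` topspace (prod_topology (discrete_topology L) Z) \<subseteq> topspace W"
    using assms by (fastforce simp: continuous_map_def Pi_iff)
  fix U
  assume "openin W U"
  then have "openin Z {z \<in> topspace Z. f (x, z) \<in> U}" if "x \<in> L" for x
    using openin_continuous_map_preimage assms[OF that] by fast
  then have "openin (prod_topology (discrete_topology L) Z)
      (\<Union>x\<in>L. {x} \<times> {z \<in> topspace Z. f (x, z) \<in> U})"
    by (intro openin_Union) (auto simp: openin_prod_Times_iff)
  also have "(\<Union>x\<in>L. {x} \<times> {z \<in> topspace Z. f (x, z) \<in> U}) =
      {p \<in> topspace (prod_topology (discrete_topology L) Z). f p \<in> U}"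
    by auto
  finally show "openin (prod_topology (discrete_topology L) Z)
      {p \<in> topspace (prod_topology (discrete_topology L) Z). f p \<in> U}" .
qed

lemma simplex_topology:
  "subtopology (powertop_real UNIV) (standard_simplex n) = top_of_set (standard_simplex n)"
  by (simp add: euclidean_product_topology)

lemma topspace_simplex_sum:
  "topspace (simplex_sum S) = {(n, X, t). X \<in> simplices S n \<and> t \<in> standard_simplex n}"
  by (auto simp: simplex_sum_def simplex_topology)

lemma openin_simplex_sum:
  assumes "X \<in> simplices S n" "openin (top_of_set (standard_simplex n)) T"
  shows "openin (simplex_sum S) ((\<lambda>t. (n, X, t)) ` T)"
proof -
  have "openin (prod_topology (discrete_topology (simplices S n)) (top_of_set (standard_simplex n)))
      ({X} \<times> T)"
    using assms by (auto simp: openin_prod_Times_iff)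
  then have "openin (simplex_sum S) (Pair n ` ({X} \<times> T))"
    unfolding simplex_sum_def simplex_topology
    using open_map_component_injection[of n UNIV "\<lambda>n. prod_topology (discrete_topology (simplices S n))
      (top_of_set (standard_simplex n))"] by (simp add: open_map_def)
  also have "Pair n ` ({X} \<times> T) = (\<lambda>t. (n, X, t)) ` T"
    by auto
  finally show ?thesis .
qed

lemma continuous_map_simplex_sum:
  "continuous_map (prod_topology (discrete_topology (simplices S n)) (top_of_set (standard_simplex n)))
     (simplex_sum S) (Pair n)"
  unfolding simplex_sum_def simplex_topology
  using continuous_map_component_injection[of n UNIV "\<lambda>n. prod_topology (discrete_topology (simplices S n))
      (top_of_set (standard_simplex n))"] by simp

text \<open>Each single simplex is open in the coproduct, so a box inside \<open>I\<close> times
  that simplex is already open in the whole product.\<close>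

lemma continuous_map_prod_simplex_sum:
  assumes "\<And>n X. X \<in> simplices S n \<Longrightarrow>
    continuous_map (prod_topology I (top_of_set (standard_simplex n))) W (\<lambda>(s, t). f (s, n, X, t))"
  shows "continuous_map (prod_topology I (simplex_sum S)) W f"
  unfolding continuous_map
proof (intro conjI allI impI)
  show "f ` topspace (prod_topology I (simplex_sum S)) \<subseteq> topspace W"
  proof clarify
    fix s n X t
    assume "(s, n, X, t) \<in> topspace (prod_topology I (simplex_sum S))"
    then show "f (s, n, X, t) \<in> topspace W"
      using continuous_map_funspace[OF assms[of X n]] by (fastforce simp: topspace_simplex_sum Pi_iff)
  qed
  fix U
  assume U: "openin W U"
  let ?P = "{p \<in> topspace (prod_topology I (simplex_sum S)). f p \<in> U}"
  show "openin (prod_topology I (simplex_sum S)) ?P"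
  proof (subst openin_subopen, intro ballI)
    fix p
    assume "p \<in> ?P"
    then obtain s n X t where p: "p = (s, n, X, t)" "s \<in> topspace I" "X \<in> simplices S n"
        "t \<in> standard_simplex n" "f (s, n, X, t) \<in> U"
      by (auto simp: topspace_simplex_sum)
    let ?Q = "{q \<in> topspace (prod_topology I (top_of_set (standard_simplex n))).
                (\<lambda>(s, t). f (s, n, X, t)) q \<in> U}"
    have "openin (prod_topology I (top_of_set (standard_simplex n))) ?Q"
      using U assms[OF p(3)] by (rule openin_continuous_map_preimage[rotated])
    moreover have "(s, t) \<in> ?Q"
      using p by simp
    ultimately have "\<exists>V T. openin I V \<and> openin (top_of_set (standard_simplex n)) T \<and>
        s \<in> V \<and> t \<in> T \<and> V \<times> T \<subseteq> ?Q"
      unfolding openin_prod_topology_alt by blast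
    then obtain V T where VT: "openin I V" "openin (top_of_set (standard_simplex n)) T"
        "s \<in> V" "t \<in> T" "V \<times> T \<subseteq> ?Q"
      by blast
    have "openin (prod_topology I (simplex_sum S)) (V \<times> (\<lambda>t. (n, X, t)) ` T)"
      using VT openin_simplex_sum[OF p(3)] by (simp add: openin_prod_Times_iff)
    moreover have "p \<in> V \<times> (\<lambda>t. (n, X, t)) ` T"
      using VT p by auto
    moreover have "V \<times> (\<lambda>t. (n, X, t)) ` T \<subseteq> ?P"
      using VT(5) p(3) by (auto simp: topspace_simplex_sum)
    ultimately show "\<exists>T. openin (prod_topology I (simplex_sum S)) T \<and> p \<in> T \<and> T \<subseteq> ?P"
      by blast
  qed
qed

lemma continuous_on_coord: "continuous_on T (coord x)"
proof -
  have "continuous_on T (\<lambda>t. t i)" for i :: nat and T :: "(nat \<Rightarrow> real) set"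
    by (rule continuous_on_subset[OF continuous_on_product_coordinates]) simp
  then show ?thesis
    unfolding coord_def by (intro continuous_intros)
qed

lemma weights_mono: "F \<subseteq> D \<Longrightarrow> weights F \<subseteq> weights D"
  by (auto simp: weights_def)

context nerve_quotient
begin

lemma quotient_map_cls: "quotient_map (simplex_sum S) (realization S) cls"
  unfolding realization_def cls_def rel_def by (rule quotient_map_quotient_topology)

lemma topspace_realization_nonempty:
  assumes "D \<noteq> {}"
  shows "topspace (realization S) \<noteq> {}"
proof -
  obtain d where "d \<in> D"
    using assms by blast
  then have "[d] \<in> N 0"
    by (simp add: N_iff)
  then have "topspace (simplex_sum S) \<noteq> {}"
    using nonempty_standard_simplex[of 0] simplices_eq[of 0] by (auto simp: topspace_simplex_sum)
  then show ?thesis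
    using quotient_imp_surjective_map[OF quotient_map_cls] by blast
qed

text \<open>The weights on a finite set form a compact Hausdorff quotient of finitely many simplices.\<close>

lemma continuous_map_point:
  assumes F: "finite F" "F \<subseteq> D"
  shows "continuous_map (top_of_set (weights F)) (realization S) point"
proof -
  \<comment> \<open>One dimension serves all weights on \<open>F\<close>: their supports have at
    most \<open>card F\<close> elements and shorter lists are padded.\<close>
  define n where "n = card F"
  define L where "L = {x \<in> N n. set x \<subseteq> F}"
  let ?Y = "prod_topology (discrete_topology L) (top_of_set (standard_simplex n))"
  have L: "L = simplices (nerve F (\<lambda>a b. b \<le> a)) n"
    using F(2) unfolding set_eq_iff by (auto simp: L_def N_iff nerve_iff)
  have "L \<subseteq> {x. set x \<subseteq> F \<and> length x = Suc n}"
    by (auto simp: L_def N_iff)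
  then have "finite L"
    using finite_lists_length_eq[OF F(1)] finite_subset by blast
  moreover have "compact_space (top_of_set (standard_simplex n))"
    using compactin_standard_simplex[of n]
    by (simp add: compact_space_subtopology euclidean_product_topology)
  ultimately have compact: "compact_space ?Y"
    by (simp add: compact_space_prod_topology compact_space_discrete_topology)
  have image: "(\<lambda>(x, t). coord x t) ` topspace ?Y = weights F"
  proof (intro subset_antisym subsetI)
    fix c
    assume c: "c \<in> weights F"
    then have "card (supp c) \<le> Suc n"
      unfolding n_def using card_mono[OF F(1), of "supp c"] by (simp add: weights_def)
    then show "c \<in> (\<lambda>(x, t). coord x t) ` topspace ?Y"
      using weights_coord[OF c] by (force simp: L)
  qed (use coord_weights(1) in \<open>auto simp: L\<close>)
  have "continuous_map ?Y (top_of_set (weights F)) (\<lambda>(x, t). coord x t)"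
    unfolding continuous_map_in_subtopology
  proof
    show "continuous_map ?Y euclidean (\<lambda>(x, t). coord x t)"
      by (rule continuous_map_prod_discrete) (simp add: continuous_on_coord)
    show "(\<lambda>(x, t). coord x t) \<in> topspace ?Y \<rightarrow> weights F"
      using image by blast
  qed
  moreover have "Hausdorff_space (top_of_set (weights F))"
    using Hausdorff_space_product_topology[of "\<lambda>_::'d. euclideanreal" UNIV]
    by (intro Hausdorff_space_subtopology) (simp add: euclidean_product_topology)
  ultimately have quot: "quotient_map ?Y (top_of_set (weights F)) (\<lambda>(x, t). coord x t)"
    by (intro T1_Spaces.continuous_imp_quotient_map) (use compact image in simp_all)
  have "continuous_map ?Y (realization S) (\<lambda>(x, t). cls (n, \<pi> x, t))"
  proof (rule continuous_map_prod_discrete)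
    fix x
    assume "x \<in> L"
    then have "\<pi> x \<in> simplices S n"
      by (auto simp: simplices_eq L_def)
    then have "continuous_map (top_of_set (standard_simplex n))
        (prod_topology (discrete_topology (simplices S n)) (top_of_set (standard_simplex n))) (Pair (\<pi> x))"
      by (intro continuous_map_pairedI) auto
    then have "continuous_map (top_of_set (standard_simplex n)) (realization S) (cls \<circ> (Pair n \<circ> Pair (\<pi> x)))"
      by (intro continuous_map_compose[OF _ quotient_imp_continuous_map[OF quotient_map_cls]]
          continuous_map_compose[OF _ continuous_map_simplex_sum])
    then show "continuous_map (top_of_set (standard_simplex n)) (realization S)
        (\<lambda>t. case (x, t) of (x, t) \<Rightarrow> cls (n, \<pi> x, t))"
      by (simp add: o_def)
  qed
  then have "continuous_map ?Y (realization S) (point \<circ> (\<lambda>(x, t). coord x t))"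
    by (rule continuous_map_eq) (auto simp: L_def point_coord)
  then show ?thesis
    by (rule continuous_compose_quotient_map[OF quot])
qed

text \<open>The hypotheses match the quotient topology: \<open>h\<close> need be continuous only on
  weights supported in a finite set, and \<open>h_finite\<close> keeps its values there inside one
  \<open>weights F\<close>, where \<open>point\<close> is continuous. Stating equivariance for pairs
  \<open>c\<close>, \<open>c'\<close> avoids the inverse of \<open>g\<close>.\<close>

lemma contractible_realization:
  fixes h :: "('d \<Rightarrow> real) \<Rightarrow> real \<Rightarrow> 'd \<Rightarrow> real"
  assumes h_weights: "\<And>c s. c \<in> weights D \<Longrightarrow> s \<in> {0..1} \<Longrightarrow> h c s \<in> weights D"
    and h_equivariant: "\<And>c c' g s d. c \<in> weights D \<Longrightarrow> c' \<in> weights D \<Longrightarrow> g \<in> \<Gamma> \<Longrightarrow>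
      (\<And>d. d \<in> D \<Longrightarrow> c' (g d) = c d) \<Longrightarrow> s \<in> {0..1} \<Longrightarrow> d \<in> D \<Longrightarrow> h c' s (g d) = h c s d"
    and h_finite: "\<And>E. finite E \<Longrightarrow> E \<subseteq> D \<Longrightarrow> \<exists>F. finite F \<and> F \<subseteq> D \<and>
      (\<forall>c\<in>weights E. \<forall>s\<in>{0..1}. supp (h c s) \<subseteq> F)"
    and h_continuous: "\<And>E. finite E \<Longrightarrow> E \<subseteq> D \<Longrightarrow>
      continuous_on ({0..1} \<times> weights E) (\<lambda>(s, c). h c s)"
    and h_0: "\<And>c. c \<in> weights D \<Longrightarrow> h c 0 = c"
    and h_1: "\<And>c. c \<in> weights D \<Longrightarrow> h c 1 = c\<^sub>1"
  shows "contractible_space (realization S)"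
proof -
  let ?I = "top_of_set {0..1::real}"
  \<comment> \<open>A simplex of \<open>S\<close> is represented by an arbitrary preimage under
    \<open>\<pi>\<close>; \<open>h_equivariant\<close> and \<open>point_invariant\<close> make the
    resulting point independent of it.\<close>
  define H where "H = (\<lambda>(s, n, X, t). point (h (coord (SOME x. x \<in> N n \<and> \<pi> x = X) t) s))"
  have H: "H (s, n, \<pi> x, t) = point (h (coord x t) s)"
    if "s \<in> {0..1}" and x: "x \<in> N n" and t: "t \<in> standard_simplex n" for s n x t
  proof -
    define y where "y = (SOME y. y \<in> N n \<and> \<pi> y = \<pi> x)"
    have y: "y \<in> N n" "\<pi> y = \<pi> x"
      unfolding y_def using someI[of "\<lambda>y. y \<in> N n \<and> \<pi> y = \<pi> x" x] x by blast+
    then obtain g where g: "g \<in> \<Gamma>" "y = map g x"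
      using proj_eqD[OF x y(1)] by auto
    have w: "coord x t \<in> weights D" "coord y t \<in> weights D"
      using x y t coord_weights by (auto simp: N_def)
    have "coord y t (g d) = coord x t d" if "d \<in> D" for d
      unfolding g(2) using x bij_Gamma[OF g(1)] that by (intro coord_map) (auto simp: bij_betw_def N_iff)
    then have "point (h (coord y t) s) = point (h (coord x t) s)"
      using w g(1) \<open>s \<in> {0..1}\<close> by (intro point_invariant[OF _ _ g(1)] h_weights h_equivariant) auto
    then show ?thesis
      by (simp add: H_def y_def)
  qed
  have cont: "continuous_map (prod_topology ?I (simplex_sum S)) (realization S) H"
  proof (rule continuous_map_prod_simplex_sum)
    fix n X
    assume "X \<in> simplices S n"
    then obtain x where x: "x \<in> N n" "X = \<pi> x"
      by (auto simp: simplices_eq)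
    then have E: "finite (set x)" "set x \<subseteq> D"
      by (auto simp: N_iff)
    then obtain F where F: "finite F" "F \<subseteq> D"
        "\<forall>c\<in>weights (set x). \<forall>s\<in>{0..1}. supp (h c s) \<subseteq> F"
      using h_finite[OF E] by blast
    have "weights (set x) \<subseteq> weights D"
      using E(2) by (rule weights_mono)
    then have hF: "h c s \<in> weights F" if "c \<in> weights (set x)" "s \<in> {0..1}" for c s
    proof -
      have "h c s \<in> weights D" "supp (h c s) \<subseteq> F"
        using that F(3) \<open>weights (set x) \<subseteq> weights D\<close> h_weights[of c s] by blast+
      then show ?thesis
        by (simp add: weights_def)
    qed
    have xE: "x \<in> simplices (nerve (set x) (\<lambda>a b. b \<le> a)) n"
      using x by (simp add: nerve_iff N_iff)
    let ?f = "\<lambda>(s, t). h (coord x t) s"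
    have "continuous_on ({0..1} \<times> standard_simplex n) ((\<lambda>(s, c). h c s) \<circ> (\<lambda>(s, t). (s, coord x t)))"
    proof (rule continuous_on_compose)
      have "continuous_on T (\<lambda>q. coord x (snd q))" for T :: "(real \<times> (nat \<Rightarrow> real)) set"
        using continuous_on_compose[OF continuous_on_snd[OF continuous_on_id] continuous_on_coord]
        by (simp add: o_def)
      then show "continuous_on ({0..1::real} \<times> standard_simplex n) (\<lambda>(s, t). (s, coord x t))"
        unfolding case_prod_unfold
        by (intro continuous_on_Pair continuous_on_fst continuous_on_id) simp
      show "continuous_on ((\<lambda>(s, t). (s, coord x t)) ` ({0..1::real} \<times> standard_simplex n)) (\<lambda>(s, c). h c s)"
        by (rule continuous_on_subset[OF h_continuous[OF E]]) (use coord_weights(1)[OF xE] in auto)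
    qed
    then have "continuous_map (prod_topology ?I (top_of_set (standard_simplex n))) (top_of_set (weights F)) ?f"
      using hF coord_weights(1)[OF xE] by (auto simp: o_def case_prod_unfold)
    then have "continuous_map (prod_topology ?I (top_of_set (standard_simplex n))) (realization S) (point \<circ> ?f)"
      using continuous_map_point[OF F(1,2)] by (rule continuous_map_compose)
    then show "continuous_map (prod_topology ?I (top_of_set (standard_simplex n))) (realization S)
        (\<lambda>(s, t). H (s, n, X, t))"
      by (rule continuous_map_eq) (use H x in auto)
  qed
  have glue: "H (s, p) = H (s, q)" if "s \<in> {0..1}" "(p, q) \<in> glue S" for s p q
  proof -
    obtain m n \<alpha> X t where pq: "p = (m, oper S m n \<alpha> X, t)" "q = (n, X, simplex_push m \<alpha> t)"
      and \<alpha>: "\<alpha> \<in> delta_maps m n" and X: "X \<in> simplices S n" and t: "t \<in> standard_simplex m"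
      using \<open>(p, q) \<in> glue S\<close> by (auto simp: glue_def)
    obtain x where x: "x \<in> N n" "X = \<pi> x"
      using X by (auto simp: simplices_eq)
    have "coord (map (\<lambda>i. x ! \<alpha> i) [0..<Suc m]) t = coord x (simplex_push m \<alpha> t)"
      using \<alpha> x by (intro coord_oper) (auto simp: N_iff)
    then show ?thesis
      unfolding pq x(2) oper_eq[OF \<alpha> x(1)]
      using H[OF \<open>s \<in> {0..1}\<close> oper_N[OF \<alpha> x(1)] t] H[OF \<open>s \<in> {0..1}\<close> x(1)]
        simplex_push_standard_simplex[OF \<alpha> t] by simp
  qed
  have cls_H: "H (s, p) = H (s, q)" if s: "s \<in> {0..1}" and "cls p = cls q" for s p q
  proof -
    have "(p, q) \<in> (glue S \<union> (glue S)\<inverse>)\<^sup>*"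
      using that by (simp add: cls_eq_iff rel_def)
    then show ?thesis
      by (induction rule: rtrancl_induct) (use glue[OF s] in auto)
  qed
  \<comment> \<open>The product of a quotient map with the interval is again a quotient map, because
    the interval is locally compact Hausdorff; so the homotopy descends jointly in both
    variables.\<close>
  have "locally_compact_space ?I"
    by (intro compact_imp_locally_compact_space) (simp add: compact_space_subtopology)
  then have "quotient_map (prod_topology ?I (simplex_sum S)) (prod_topology ?I (realization S))
      (\<lambda>(s, p). (s, cls p))"
    by (intro quotient_map_prod_right quotient_map_cls) (simp_all add: Hausdorff_space_subtopology)
  then have quot: "quotient_map (prod_topology ?I (simplex_sum S)) (prod_topology ?I (realization S))
      (\<lambda>q. (fst q, cls (snd q)))"
    by (simp add: case_prod_unfold)
  obtain K where K: "continuous_map (prod_topology ?I (realization S)) (realization S) K"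
    and KH: "\<And>q. q \<in> topspace (prod_topology ?I (simplex_sum S)) \<Longrightarrow> K (fst q, cls (snd q)) = H q"
  proof (rule quotient_map_lift_exists[OF quot cont])
    fix p q
    assume "p \<in> topspace (prod_topology ?I (simplex_sum S))"
      and "(fst p, cls (snd p)) = (fst q, cls (snd q))"
    then show "H p = H q"
      using cls_H[of "fst p" "snd p" "snd q"] by (simp add: mem_Times_iff) (metis prod.collapse)
  qed blast
  have K_cls: "K (s, cls (n, \<pi> x, t)) = point (h (coord x t) s)"
    if "s \<in> {0..1}" "x \<in> N n" "t \<in> standard_simplex n" for s x n t
  proof -
    have "(s, n, \<pi> x, t) \<in> topspace (prod_topology ?I (simplex_sum S))"
      using that by (simp add: topspace_simplex_sum simplices_eq)
    then show ?thesis
      using KH H[OF that] by fastforce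
  qed
  have rep: "\<exists>x n t. x \<in> N n \<and> t \<in> standard_simplex n \<and> q = cls (n, \<pi> x, t)"
    if "q \<in> topspace (realization S)" for q
  proof -
    have "q \<in> cls ` topspace (simplex_sum S)"
      using that by (simp only: quotient_imp_surjective_map[OF quotient_map_cls])
    then obtain n X t where X: "q = cls (n, X, t)" "X \<in> simplices S n" "t \<in> standard_simplex n"
      unfolding topspace_simplex_sum by blast
    then obtain x where "x \<in> N n" "X = \<pi> x"
      unfolding simplices_eq by blast
    with X show ?thesis
      by blast
  qed
  have "K (0, q) = id q \<and> K (1, q) = point c\<^sub>1" if q: "q \<in> topspace (realization S)" for q
  proof -
    obtain x n t where *: "x \<in> N n" "t \<in> standard_simplex n" "q = cls (n, \<pi> x, t)"
      using rep[OF q] by blast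
    moreover have "coord x t \<in> weights D"
      using * coord_weights by (auto simp: N_def)
    ultimately show ?thesis
      using K_cls[of _ x n t] point_coord[of x n t] h_0 h_1 by simp
  qed
  then have "homotopic_with (\<lambda>_. True) (realization S) (realization S) id (\<lambda>_. point c\<^sub>1)"
    using K by (subst homotopic_with) auto
  then show ?thesis
    unfolding contractible_space_def by blast
qed

end

section \<open>Deforming weights on a poset\<close>

definition order_chains :: "'a::order set \<Rightarrow> 'a set set" where
  "order_chains A = {\<sigma>. \<sigma> \<subseteq> A \<and> finite \<sigma> \<and> \<sigma> \<noteq> {} \<and> comparable \<sigma>}"

text \<open>The total is left free: \<open>mass\<close> counts each chain with its number of
  elements, and \<open>slide\<close> adds mass at \<open>p\<close> without regard to the total of
  \<open>w\<close>.\<close>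

definition cone_weights :: "'a::order set \<Rightarrow> ('a \<Rightarrow> real) set" where
  "cone_weights A = {w. finite (supp w) \<and> supp w \<subseteq> A \<and> comparable (supp w) \<and>
                        (\<forall>a. 0 \<le> w a) \<and> supp w \<noteq> {}}"

definition mass :: "('a set \<Rightarrow> real) \<Rightarrow> 'a \<Rightarrow> real" where
  "mass c a = (\<Sum>\<sigma> | \<sigma> \<in> supp c \<and> a \<in> \<sigma>. c \<sigma>)"

definition below :: "('a::order \<Rightarrow> real) \<Rightarrow> 'a \<Rightarrow> real" where
  "below w a = (\<Sum>b | b \<in> supp w \<and> b < a. w b)"

text \<open>If the masses occupy consecutive intervals of the line, in the order of the support,
  this is the length of the part of the interval from \<open>below w a\<close> to
  \<open>below w a + w a\<close> that lies under \<open>\<theta>\<close>.\<close>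

definition kept :: "real \<Rightarrow> ('a::order \<Rightarrow> real) \<Rightarrow> 'a \<Rightarrow> real" where
  "kept \<theta> w a = min (below w a + w a) \<theta> - min (below w a) \<theta>"

text \<open>As \<open>\<theta>\<close> falls from the total mass to 0, this passes from
  \<open>w\<close> to its pushforward along \<open>f\<close>.\<close>

definition shift :: "('a::order \<Rightarrow> 'a) \<Rightarrow> real \<Rightarrow> ('a \<Rightarrow> real) \<Rightarrow> 'a \<Rightarrow> real" where
  "shift f \<theta> w b = kept \<theta> w b + (\<Sum>a | a \<in> supp w \<and> f a = b. w a - kept \<theta> w a)"

definition slide :: "('a::order \<Rightarrow> 'a) \<Rightarrow> 'a \<Rightarrow> real \<Rightarrow> real \<Rightarrow> ('a \<Rightarrow> real) \<Rightarrow> 'a \<Rightarrow> real" where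
  "slide f p u \<theta> w b = (1 - u) * shift f \<theta> w b + (if b = p then u else 0)"

text \<open>The length of the interval of heights at which the superlevel set of \<open>w\<close> is \<open>\<sigma>\<close>.\<close>

definition levels :: "('a \<Rightarrow> real) \<Rightarrow> 'a set \<Rightarrow> real" where
  "levels w \<sigma> = (if finite \<sigma> \<and> \<sigma> \<noteq> {}
     then max 0 (Min (w ` \<sigma>) - Max (insert 0 (w ` (supp w - \<sigma>)))) else 0)"

definition normalize_weight :: "('a \<Rightarrow> real) \<Rightarrow> 'a \<Rightarrow> real" where
  "normalize_weight c a = c a / sum c (supp c)"

lemma supp_pos: "w \<in> cone_weights A \<Longrightarrow> a \<in> supp w \<longleftrightarrow> 0 < w a"
  unfolding supp_def cone_weights_def
  by (metis (mono_tags, lifting) less_le mem_Collect_eq)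

lemma sum_supp_pos: "w \<in> cone_weights A \<Longrightarrow> 0 < sum w (supp w)"
  using supp_pos[of w A] by (intro sum_pos) (auto simp: cone_weights_def)

lemma weights_cone: "c \<in> weights A \<Longrightarrow> c \<in> cone_weights A"
  by (auto simp: weights_def cone_weights_def)

text \<open>The union of a nonempty finite chain of sets is its largest member, so proper subsets of
  \<sigma> forming a chain cannot exhaust \<sigma>.\<close>

lemma comparable_Union_less:
  assumes "finite T" "comparable T" "\<And>\<tau>. \<tau> \<in> T \<Longrightarrow> \<tau> \<subset> \<sigma>" "\<sigma> \<noteq> {}"
  shows "\<exists>a\<in>\<sigma>. \<forall>\<tau>\<in>T. a \<notin> \<tau>"
proof (cases "T = {}")
  case True
  then show ?thesis
    using assms(4) by blast
next
  case False
  then obtain M where M: "M \<in> T" "\<And>\<tau>. \<tau> \<in> T \<Longrightarrow> M \<subseteq> \<tau> \<Longrightarrow> \<tau> = M"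
    using finite_has_maximal[OF assms(1)] by metis
  then have "\<tau> \<subseteq> M" if "\<tau> \<in> T" for \<tau>
    using assms(2) that by (auto simp: comparable_def)
  then show ?thesis
    using assms(3)[OF M(1)] by blast
qed

lemma comparable_less_Inter:
  assumes "finite T" "comparable T" "\<And>\<tau>. \<tau> \<in> T \<Longrightarrow> \<sigma> \<subset> \<tau>" "T \<noteq> {}"
  shows "\<exists>b. b \<notin> \<sigma> \<and> (\<forall>\<tau>\<in>T. b \<in> \<tau>)"
proof -
  obtain M where M: "M \<in> T" "\<And>\<tau>. \<tau> \<in> T \<Longrightarrow> \<tau> \<subseteq> M \<Longrightarrow> \<tau> = M"
    using finite_has_minimal[OF assms(1,4)] by metis
  then have "M \<subseteq> \<tau>" if "\<tau> \<in> T" for \<tau>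
    using assms(2) that by (auto simp: comparable_def)
  then show ?thesis
    using assms(3)[OF M(1)] by blast
qed

lemma normalize_weight_weights:
  assumes "c \<in> cone_weights D"
  shows "normalize_weight c \<in> weights D" "supp (normalize_weight c) = supp c"
proof -
  have "0 < sum c (supp c)"
    using assms by (rule sum_supp_pos)
  then show s: "supp (normalize_weight c) = supp c"
    by (auto simp: supp_def normalize_weight_def)
  have "sum (normalize_weight c) (supp c) = 1"
    using \<open>0 < sum c (supp c)\<close> unfolding normalize_weight_def sum_divide_distrib[symmetric] by simp
  then show "normalize_weight c \<in> weights D"
    using assms \<open>0 < sum c (supp c)\<close>
    by (simp add: weights_def cone_weights_def s) (simp add: normalize_weight_def)
qed

lemma normalize_weight_id: "c \<in> weights D \<Longrightarrow> normalize_weight c = c"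
  by (auto simp: weights_def normalize_weight_def)

section \<open>Passing between weights on chains and functions on the poset\<close>

lemma supp_mass:
  assumes "c \<in> cone_weights (order_chains A)"
  shows "supp (mass c) = \<Union> (supp c)"
proof -
  have fin: "finite (supp c)"
    using assms by (simp add: cone_weights_def)
  have "mass c a = 0 \<longleftrightarrow> (\<forall>\<sigma>. \<sigma> \<in> supp c \<and> a \<in> \<sigma> \<longrightarrow> c \<sigma> = 0)" for a
    unfolding mass_def using fin assms
    by (subst sum_nonneg_eq_0_iff) (auto simp: cone_weights_def)
  then show ?thesis
    using supp_pos[OF assms] by (fastforce simp: supp_def)
qed

lemma mass_cone:
  assumes c: "c \<in> cone_weights (order_chains A)"
  shows "mass c \<in> cone_weights A"
proof -
  have "comparable (\<Union> (supp c))"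
    unfolding comparable_def
  proof clarify
    fix a b \<sigma> \<tau>
    assume *: "a \<in> \<sigma>" "\<sigma> \<in> supp c" "b \<in> \<tau>" "\<tau> \<in> supp c" "\<not> b \<le> a"
    then have "\<sigma> \<subseteq> \<tau> \<or> \<tau> \<subseteq> \<sigma>" "comparable \<sigma>" "comparable \<tau>"
      using c by (auto simp: cone_weights_def order_chains_def comparable_def)
    then show "a \<le> b"
      using * unfolding comparable_def by blast
  qed
  moreover have "0 \<le> mass c a" for a
    unfolding mass_def using c by (intro sum_nonneg) (auto simp: cone_weights_def)
  moreover have "finite (\<Union> (supp c))" "\<Union> (supp c) \<subseteq> A"
    using c by (auto simp: cone_weights_def order_chains_def)
  moreover have "\<Union> (supp c) \<noteq> {}"
    using c unfolding cone_weights_def order_chains_def by blast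
  ultimately show ?thesis
    unfolding cone_weights_def mem_Collect_eq supp_mass[OF c] by blast
qed

text \<open>The 0 adjoined in \<open>levels\<close> has two purposes: it forces \<open>w\<close> to
  be positive on \<sigma>, and it is the value to compare with when \<sigma> is the whole
  support.\<close>

lemma levels_neq_0:
  assumes "finite (supp w)"
  shows "levels w \<sigma> \<noteq> 0 \<longleftrightarrow> finite \<sigma> \<and> \<sigma> \<noteq> {} \<and>
    (\<forall>a\<in>\<sigma>. 0 < w a \<and> (\<forall>b\<in>supp w - \<sigma>. w b < w a))"
proof (cases "finite \<sigma> \<and> \<sigma> \<noteq> {}")
  case True
  have "max 0 (x - y) \<noteq> 0 \<longleftrightarrow> y < x" for x y :: real
    by auto
  then have "levels w \<sigma> \<noteq> 0 \<longleftrightarrow> Max (insert 0 (w ` (supp w - \<sigma>))) < Min (w ` \<sigma>)"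
    unfolding levels_def using True by presburger
  also have "\<dots> \<longleftrightarrow> (\<forall>x\<in>insert 0 (w ` (supp w - \<sigma>)). \<forall>y\<in>w ` \<sigma>. x < y)"
    using True assms by (subst Max_less_iff) (auto simp: Min_gr_iff)
  finally show ?thesis
    using True by auto
qed (auto simp: levels_def)

lemma supp_levels:
  assumes "finite (supp w)"
  shows "supp (levels w) \<subseteq> Pow (supp w)"
proof
  fix \<sigma>
  assume "\<sigma> \<in> supp (levels w)"
  then have "\<forall>a\<in>\<sigma>. 0 < w a"
    using levels_neq_0[OF assms, of \<sigma>] by (simp add: supp_def)
  then show "\<sigma> \<in> Pow (supp w)"
    by (force simp: supp_def)
qed

text \<open>Superlevel sets of one function are nested, so the support is a chain under inclusion.
  The set where \<open>w\<close> is largest has positive level, so the support is nonempty.\<close>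

lemma levels_cone:
  assumes w: "w \<in> cone_weights A"
  shows "levels w \<in> cone_weights (order_chains A)"
proof -
  have fin: "finite (supp w)" and comp: "comparable (supp w)" and sub: "supp w \<subseteq> A" and ne: "supp w \<noteq> {}"
    using w by (auto simp: cone_weights_def)
  note ne0 = levels_neq_0[OF fin]
  have "finite (supp (levels w))"
    using supp_levels[OF fin] fin by (meson finite_Pow_iff finite_subset)
  moreover have "supp (levels w) \<subseteq> order_chains A"
  proof
    fix \<sigma>
    assume \<sigma>: "\<sigma> \<in> supp (levels w)"
    then have "finite \<sigma>" "\<sigma> \<noteq> {}"
      using ne0[of \<sigma>] by (simp_all add: supp_def)
    moreover have "\<sigma> \<subseteq> supp w"
      using \<sigma> supp_levels[OF fin] by blast
    ultimately show "\<sigma> \<in> order_chains A"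
      using comp sub comparable_subset unfolding order_chains_def by blast
  qed
  moreover have "comparable (supp (levels w))"
    unfolding comparable_def
  proof (intro ballI)
    fix \<sigma> \<tau>
    assume *: "\<sigma> \<in> supp (levels w)" "\<tau> \<in> supp (levels w)"
    then have 1: "\<forall>a\<in>\<sigma>. \<forall>b\<in>supp w - \<sigma>. w b < w a" "\<forall>a\<in>\<tau>. \<forall>b\<in>supp w - \<tau>. w b < w a"
      using ne0 by (auto simp: supp_def)
    have "\<sigma> \<subseteq> supp w" "\<tau> \<subseteq> supp w"
      using * supp_levels[OF fin] by auto
    with 1 show "\<sigma> \<subseteq> \<tau> \<or> \<tau> \<subseteq> \<sigma>"
      by (meson DiffI less_asym subset_iff)
  qed
  moreover have "0 \<le> levels w \<sigma>" for \<sigma>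
    by (simp add: levels_def)
  moreover have "supp (levels w) \<noteq> {}"
  proof -
    let ?\<sigma> = "{a \<in> supp w. w a = Max (w ` supp w)}"
    have "Max (w ` supp w) \<in> w ` supp w"
      using fin ne by (intro Max_in) auto
    moreover have "w b < Max (w ` supp w)" if "b \<in> supp w - ?\<sigma>" for b
      using that fin Max_ge[of "w ` supp w" "w b"] by (auto simp: less_le)
    moreover have "finite ?\<sigma>"
      using fin by simp
    moreover have "0 < w a" if "a \<in> ?\<sigma>" for a
      using that supp_pos[OF w] by simp
    ultimately have "levels w ?\<sigma> \<noteq> 0"
      unfolding ne0 by fastforce
    then show ?thesis
      by (auto simp: supp_def)
  qed
  ultimately show ?thesis
    unfolding cone_weights_def by blast
qed

text \<open>A layer-cake formula. If \<sigma> is comparable to all sets in the support of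
  \<open>c\<close>, the minimum of \<open>mass c\<close> on \<sigma> sums \<open>c\<close> over the
  sets containing \<sigma>, the maximum off \<sigma> sums over those strictly containing it, and the
  difference is \<open>c \<sigma>\<close>. The homotopy therefore starts at the identity.\<close>

lemma levels_mass:
  assumes c: "c \<in> cone_weights (order_chains A)"
  shows "levels (mass c) = c"
proof
  fix \<sigma>
  define w where "w = mass c"
  define T where "T = supp c"
  have T: "finite T" "comparable T" "T \<subseteq> order_chains A" and c0: "\<And>\<tau>. 0 \<le> c \<tau>"
    using c by (auto simp: cone_weights_def T_def)
  have w: "w a = sum c {\<tau> \<in> T. a \<in> \<tau>}" for a
    by (simp add: w_def mass_def T_def)
  have sw: "supp w = \<Union> T"
    using supp_mass[OF c] by (simp add: w_def T_def)
  have fin: "finite (supp w)"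
    using T by (auto simp: sw order_chains_def)
  have w0: "0 \<le> w a" for a
    unfolding w using c0 by (intro sum_nonneg) auto
  show "levels (mass c) \<sigma> = c \<sigma>"
  proof (cases "finite \<sigma> \<and> \<sigma> \<noteq> {}")
    case False
    then have "\<sigma> \<notin> T"
      using T(3) by (auto simp: order_chains_def)
    then show ?thesis
      using False by (auto simp: levels_def T_def supp_def)
  next
    case \<sigma>: True
    \<comment> \<open>The right distinction is comparability with \<open>T\<close>, not membership:
      a comparable \<sigma> outside \<open>T\<close> obeys the same formula with
      \<open>c \<sigma> = 0\<close>.\<close>
    show ?thesis
    proof (cases "\<forall>\<tau>\<in>T. \<sigma> \<subseteq> \<tau> \<or> \<tau> \<subseteq> \<sigma>")
      case True
      let ?T' = "{\<tau> \<in> T. \<sigma> \<subset> \<tau>}"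
      \<comment> \<open>The minimum is attained at an element of \<sigma> that lies in no smaller
        member of \<open>T\<close>.\<close>
      have "\<exists>a\<in>\<sigma>. \<forall>\<tau>\<in>{\<tau> \<in> T. \<tau> \<subset> \<sigma>}. a \<notin> \<tau>"
      proof (rule comparable_Union_less)
        show "finite {\<tau> \<in> T. \<tau> \<subset> \<sigma>}" "comparable {\<tau> \<in> T. \<tau> \<subset> \<sigma>}"
          using T(1) comparable_subset[OF T(2)] by auto
      qed (use \<sigma> in auto)
      then obtain a where a: "a \<in> \<sigma>" "\<And>\<tau>. \<tau> \<in> T \<Longrightarrow> \<tau> \<subset> \<sigma> \<Longrightarrow> a \<notin> \<tau>"
        by blast
      have "{\<tau> \<in> T. a \<in> \<tau>} = {\<tau> \<in> T. \<sigma> \<subseteq> \<tau>}"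
        using a True by blast
      then have wa: "w a = sum c {\<tau> \<in> T. \<sigma> \<subseteq> \<tau>}"
        by (simp add: w)
      have "w a \<le> w a'" if "a' \<in> \<sigma>" for a'
        unfolding wa w[of a'] using that T c0 by (intro sum_mono2) auto
      then have Min: "Min (w ` \<sigma>) = sum c {\<tau> \<in> T. \<sigma> \<subseteq> \<tau>}"
        using \<sigma> wa by (intro Min_eqI) (auto intro: rev_image_eqI[OF a(1)])
      have le: "w b \<le> sum c ?T'" if "b \<notin> \<sigma>" for b
        unfolding w[of b] using that T c0 True by (intro sum_mono2) auto
      \<comment> \<open>The maximum is attained at an element outside \<sigma> common to all larger
        members of \<open>T\<close>; if there are none, it is the adjoined 0.\<close>
      have attained: "sum c ?T' \<in> insert 0 (w ` (supp w - \<sigma>))"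
      proof (cases "?T' = {}")
        case False
        have "\<exists>b. b \<notin> \<sigma> \<and> (\<forall>\<tau>\<in>?T'. b \<in> \<tau>)"
        proof (rule comparable_less_Inter)
          show "finite ?T'" "comparable ?T'"
            using T(1) comparable_subset[OF T(2)] by auto
        qed (use False in auto)
        then obtain b where b: "b \<notin> \<sigma>" "\<And>\<tau>. \<tau> \<in> ?T' \<Longrightarrow> b \<in> \<tau>"
          by blast
        have "{\<tau> \<in> T. b \<in> \<tau>} = ?T'"
          using b True by blast
        then have "sum c ?T' = w b"
          by (simp add: w)
        moreover have "b \<in> supp w - \<sigma>"
          using False b by (auto simp: sw)
        ultimately show ?thesis
          by blast
      qed (simp only: sum.empty insertI1)
      have "0 \<le> sum c ?T'"
        using c0 by (intro sum_nonneg) auto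
      then have Max: "Max (insert 0 (w ` (supp w - \<sigma>))) = sum c ?T'"
        using fin le attained by (intro Max_eqI) auto
      have "{\<tau> \<in> T. \<sigma> \<subseteq> \<tau>} - {\<sigma>} = ?T'"
        by auto
      moreover have "c \<sigma> = 0" if "\<sigma> \<notin> T"
        using that by (simp add: T_def supp_def)
      ultimately have "sum c {\<tau> \<in> T. \<sigma> \<subseteq> \<tau>} = c \<sigma> + sum c ?T'"
        using T(1) sum.remove[of "{\<tau> \<in> T. \<sigma> \<subseteq> \<tau>}" \<sigma> c]
        by (cases "\<sigma> \<in> T") (auto simp: psubset_eq intro!: sum.cong)
      then have "Min (w ` \<sigma>) - Max (insert 0 (w ` (supp w - \<sigma>))) = c \<sigma>"
        unfolding Min Max by simp
      then show ?thesis
        using c0[of \<sigma>] \<sigma> by (simp add: levels_def w_def)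
    next
      case False
      \<comment> \<open>Every member of \<open>T\<close> through \<open>a\<close> contains \<tau>,
        hence \<open>b\<close>. So \<open>w a \<le> w b\<close> with \<open>a\<close> inside and
        \<open>b\<close> outside, and \<sigma> is no superlevel set.\<close>
      then obtain \<tau> a b where \<tau>: "\<tau> \<in> T" "a \<in> \<sigma>" "a \<notin> \<tau>" "b \<in> \<tau>" "b \<notin> \<sigma>"
        by blast
      have "\<tau> \<subseteq> \<rho>" if "\<rho> \<in> T" "a \<in> \<rho>" for \<rho>
        using that \<tau> T(2) unfolding comparable_def by blast
      then have "w a \<le> w b"
        unfolding w using \<tau> T c0 by (intro sum_mono2) auto
      moreover have "b \<in> supp w - \<sigma>"
        using \<tau> by (auto simp: sw)
      ultimately have "levels w \<sigma> = 0"
        using levels_neq_0[OF fin, of \<sigma>] \<tau>(2) by (meson leD)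
      moreover have "\<sigma> \<notin> T"
        using \<tau> T(2) False by (auto simp: comparable_def)
      ultimately show ?thesis
        by (simp add: T_def supp_def w_def)
    qed
  qed
qed

section \<open>Sliding mass along an increasing map\<close>

lemma below_nonneg: "w \<in> cone_weights A \<Longrightarrow> 0 \<le> below w a"
  unfolding below_def by (intro sum_nonneg) (auto simp: cone_weights_def)

lemma kept_bounds:
  assumes "w \<in> cone_weights A"
  shows "0 \<le> kept \<theta> w a" "kept \<theta> w a \<le> w a"
proof -
  have "0 \<le> w a"
    using assms by (auto simp: cone_weights_def)
  then show "0 \<le> kept \<theta> w a" "kept \<theta> w a \<le> w a"
    by (auto simp: kept_def min_def)
qed

lemma kept_zero:
  assumes "w \<in> cone_weights A"
  shows "kept 0 w a = 0"
proof -
  have "0 \<le> w a"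
    using assms by (auto simp: cone_weights_def)
  then show ?thesis
    using below_nonneg[OF assms, of a] by (simp add: kept_def)
qed

lemma shift_nonneg:
  assumes "w \<in> cone_weights A"
  shows "0 \<le> shift f \<theta> w b"
  unfolding shift_def using kept_bounds[OF assms] by (intro add_nonneg_nonneg sum_nonneg) auto

lemma supp_shift:
  assumes w: "w \<in> cone_weights A" and b: "b \<in> supp (shift f \<theta> w)"
  shows "b \<in> supp w \<and> 0 < kept \<theta> w b \<or> (\<exists>a\<in>supp w. f a = b \<and> kept \<theta> w a < w a)"
proof (rule ccontr)
  assume *: "\<not> ?thesis"
  have "kept \<theta> w b = 0"
    using * kept_bounds[OF w, of \<theta> b] by (force simp: supp_def)
  moreover have "w a - kept \<theta> w a = 0" if "a \<in> supp w" "f a = b" for a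
    using * that kept_bounds[OF w, of \<theta> a] by force
  ultimately have "shift f \<theta> w b = 0"
    by (simp add: shift_def)
  with b show False
    by (simp add: supp_def)
qed

text \<open>The intervals of length \<open>w a\<close> are laid out in the order of the chain; only the mass above the
  threshold \<open>\<theta>\<close> is moved by \<open>f\<close>, so everything that stays lies below everything that moves.\<close>

lemma kept_moved_le:
  assumes w: "w \<in> cone_weights A" and a: "a \<in> supp w" "0 < kept \<theta> w a"
    and b: "b \<in> supp w" "kept \<theta> w b < w b"
  shows "a \<le> b"
proof (rule ccontr)
  assume "\<not> a \<le> b"
  moreover have "a \<le> b \<or> b \<le> a"
    using w a(1) b(1) unfolding cone_weights_def comparable_def by blast
  ultimately have "b < a"
    by (simp add: less_le_not_le)
  have "below w b + w b = sum w (insert b {x. x \<in> supp w \<and> x < b})"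
    using w by (simp add: below_def cone_weights_def)
  also have "\<dots> \<le> below w a"
    unfolding below_def using w b(1) \<open>b < a\<close> by (intro sum_mono2) (auto simp: cone_weights_def)
  finally have "below w b + w b \<le> below w a" .
  moreover have "below w a < \<theta>" "\<theta> < below w b + w b"
    using a(2) b(2) by (auto simp: kept_def min_def split: if_splits)
  ultimately show False
    by simp
qed

text \<open>The support consists of staying points \<open>a\<close>, images \<open>f b\<close> of
  moved points, and possibly \<open>p\<close>. Images are comparable by monotonicity, a staying
  \<open>a\<close> satisfies \<open>a \<le> b \<le> f b\<close>, and \<open>p\<close> is added only
  when nothing stays, so it lies below everything else. The bound on the support is independent of
  \<open>u\<close> and \<open>\<theta>\<close>, as continuity will require.\<close>

lemma slide_cone:
  fixes A :: "'a::order set"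
  assumes f_closed: "\<And>a. a \<in> A \<Longrightarrow> f a \<in> A"
    and f_mono: "\<And>a b. a \<in> A \<Longrightarrow> b \<in> A \<Longrightarrow> a \<le> b \<Longrightarrow> f a \<le> f b"
    and f_increasing: "\<And>a. a \<in> A \<Longrightarrow> a \<le> f a"
    and p_le: "p \<in> A" "\<And>a. a \<in> A \<Longrightarrow> p \<le> f a"
    and w: "w \<in> cone_weights A" and u: "0 \<le> u" "u \<le> 1" "0 < u \<Longrightarrow> \<theta> = 0"
  shows "slide f p u \<theta> w \<in> cone_weights A"
    and "supp (slide f p u \<theta> w) \<subseteq> supp w \<union> f ` supp w \<union> {p}"
proof -
  have fin: "finite (supp w)" and comp: "comparable (supp w)" and sub: "supp w \<subseteq> A" and ne: "supp w \<noteq> {}"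
    using w by (auto simp: cone_weights_def)
  have supp_slide: "b \<in> supp (shift f \<theta> w) \<or> 0 < u \<and> b = p" if "b \<in> supp (slide f p u \<theta> w)" for b
    using that u by (auto simp: supp_def slide_def split: if_splits)
  show ss: "supp (slide f p u \<theta> w) \<subseteq> supp w \<union> f ` supp w \<union> {p}"
    using supp_slide supp_shift[OF w] by blast
  have mixed: "a \<le> f b" if "a \<in> supp w" "0 < kept \<theta> w a" "b \<in> supp w" "kept \<theta> w b < w b" for a b
    using kept_moved_le[OF w that] f_increasing[of b] sub that by (meson order_trans subsetD)
  have ff: "f a \<le> f b \<or> f b \<le> f a" if "a \<in> supp w" "b \<in> supp w" for a b
    using that comp sub f_mono unfolding comparable_def by (meson subsetD)
  have "comparable (supp (shift f \<theta> w))"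
    unfolding comparable_def
  proof (intro ballI)
    fix x y
    assume "x \<in> supp (shift f \<theta> w)" "y \<in> supp (shift f \<theta> w)"
    then show "x \<le> y \<or> y \<le> x"
      using supp_shift[OF w] mixed ff comp unfolding comparable_def by metis
  qed
  moreover have "p \<le> b" if "b \<in> supp (shift f \<theta> w)" "0 < u" for b
    using supp_shift[OF w that(1)] kept_zero[OF w, of b] u(3)[OF that(2)] p_le(2) sub by auto
  ultimately have "comparable (supp (slide f p u \<theta> w))"
    using supp_slide unfolding comparable_def by blast
  moreover have "0 \<le> slide f p u \<theta> w b" for b
    unfolding slide_def using u shift_nonneg[OF w] by (auto intro!: add_nonneg_nonneg)
  moreover have "supp (slide f p u \<theta> w) \<noteq> {}"
  proof (cases "u = 0")
    case True
    obtain a where a: "a \<in> supp w"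
      using ne by blast
    \<comment> \<open>Either part of the mass of \<open>a\<close> stays at \<open>a\<close>, or all
      of it arrives at \<open>f a\<close>.\<close>
    have "0 < shift f \<theta> w a \<or> 0 < shift f \<theta> w (f a)"
    proof (cases "0 < kept \<theta> w a")
      case True
      then have "0 < shift f \<theta> w a"
        unfolding shift_def using kept_bounds[OF w] by (intro add_pos_nonneg sum_nonneg) auto
      then show ?thesis ..
    next
      case False
      then have "kept \<theta> w a = 0"
        using kept_bounds[OF w, of \<theta> a] by simp
      then have "0 < w a - kept \<theta> w a"
        using supp_pos[OF w] a by simp
      also have "\<dots> \<le> (\<Sum>x | x \<in> supp w \<and> f x = f a. w x - kept \<theta> w x)"
        using fin a kept_bounds[OF w] by (intro member_le_sum) auto
      finally have "0 < shift f \<theta> w (f a)"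
        unfolding shift_def using kept_bounds[OF w, of \<theta> "f a"] by simp
      then show ?thesis ..
    qed
    then show ?thesis
      using True by (fastforce simp: supp_def slide_def)
  next
    case False
    then have "0 < slide f p u \<theta> w p"
      unfolding slide_def using u shift_nonneg[OF w, of f \<theta> p] by (auto intro: add_nonneg_pos)
    then have "p \<in> supp (slide f p u \<theta> w)"
      by (simp add: supp_def)
    then show ?thesis
      by blast
  qed
  moreover have "finite (supp (slide f p u \<theta> w))"
    using ss fin by (meson finite.emptyI finite_UnI finite_imageI finite_insert finite_subset)
  moreover have "supp (slide f p u \<theta> w) \<subseteq> A"
    using ss sub f_closed p_le(1) by blast
  ultimately show "slide f p u \<theta> w \<in> cone_weights A"
    unfolding cone_weights_def by blast
qed

text \<open>No interval extends beyond the total mass, so with that threshold everything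
  stays.\<close>

lemma slide_start:
  assumes w: "w \<in> cone_weights A"
  shows "slide f p 0 (sum w (supp w)) w = w"
proof -
  have "kept (sum w (supp w)) w a = w a" for a
  proof (cases "a \<in> supp w")
    case True
    have "below w a + w a = sum w (insert a {x. x \<in> supp w \<and> x < a})"
      using w by (simp add: below_def cone_weights_def)
    also have "\<dots> \<le> sum w (supp w)"
      using w True by (intro sum_mono2) (auto simp: cone_weights_def)
    finally show ?thesis
      using supp_pos[OF w] True by (simp add: kept_def min_def)
  qed (simp add: kept_def supp_def)
  then show ?thesis
    by (simp add: slide_def shift_def fun_eq_iff)
qed

section \<open>Continuity of the constructions in the weight\<close>

lemma continuous_on_Min_image:
  fixes w :: "'z::topological_space \<Rightarrow> 'a \<Rightarrow> real"
  assumes "finite \<sigma>" "\<sigma> \<noteq> {}" "\<And>a. continuous_on T (\<lambda>z. w z a)"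
  shows "continuous_on T (\<lambda>z. Min (w z ` \<sigma>))"
  using assms(1,2) by (induction rule: finite_ne_induct) (auto intro!: continuous_intros assms(3))

lemma continuous_on_Max_insert_image:
  fixes w :: "'z::topological_space \<Rightarrow> 'a \<Rightarrow> real"
  assumes "finite \<sigma>" "\<And>a. continuous_on T (\<lambda>z. w z a)"
  shows "continuous_on T (\<lambda>z. Max (insert 0 (w z ` \<sigma>)))"
  using assms(1)
proof (induction rule: finite_induct)
  case (insert a \<sigma>)
  have "Max (insert 0 (w z ` insert a \<sigma>)) = max (w z a) (Max (insert 0 (w z ` \<sigma>)))" for z
    using insert.hyps(1) by (subst Max_insert[symmetric]) (auto simp: insert_commute)
  then show ?case
    using insert.IH assms(2) by (simp add: continuous_on_max)
qed simp

text \<open>The index set varies with \<open>z\<close>; as \<open>v\<close> vanishes wherever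
  \<open>w\<close> does, it may be replaced by a fixed subset of the finite set
  \<open>E\<close>.\<close>

lemma continuous_on_sum_supp:
  fixes w v :: "'z::topological_space \<Rightarrow> 'a \<Rightarrow> real"
  assumes "finite E" "\<And>z. z \<in> T \<Longrightarrow> supp (w z) \<subseteq> E" "\<And>a. continuous_on T (\<lambda>z. v z a)"
    and "\<And>z a. z \<in> T \<Longrightarrow> w z a = 0 \<Longrightarrow> v z a = 0"
  shows "continuous_on T (\<lambda>z. \<Sum>a | a \<in> supp (w z) \<and> Q a. v z a)"
proof (rule continuous_on_eq)
  show "continuous_on T (\<lambda>z. \<Sum>a\<in>{a \<in> E. Q a}. v z a)"
    by (intro continuous_intros assms(3))
  show "(\<Sum>a\<in>{a \<in> E. Q a}. v z a) = (\<Sum>a | a \<in> supp (w z) \<and> Q a. v z a)" if "z \<in> T" for z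
    using assms(1) assms(2,4)[OF that] by (intro sum.mono_neutral_right) (auto simp: supp_def)
qed

context
  fixes w :: "'z::topological_space \<Rightarrow> 'a \<Rightarrow> real" and T E
  assumes fin: "finite E" and sub: "\<And>z. z \<in> T \<Longrightarrow> supp (w z) \<subseteq> E"
    and cont: "\<And>a. continuous_on T (\<lambda>z. w z a)"
begin

lemma continuous_on_total: "continuous_on T (\<lambda>z. sum (w z) (supp (w z)))"
  using continuous_on_sum_supp[OF fin sub cont, where Q = "\<lambda>_. True"] by simp

lemma continuous_on_levels:
  assumes "\<And>z a. z \<in> T \<Longrightarrow> 0 \<le> w z a"
  shows "continuous_on T (\<lambda>z. levels (w z) \<sigma>)"
proof (cases "finite \<sigma> \<and> \<sigma> \<noteq> {}")
  case True
  show ?thesis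
  proof (rule continuous_on_eq)
    show "continuous_on T (\<lambda>z. max 0 (Min (w z ` \<sigma>) - Max (insert 0 (w z ` (E - \<sigma>)))))"
      using True fin
      by (intro continuous_intros continuous_on_Min_image continuous_on_Max_insert_image cont) auto
    fix z
    assume "z \<in> T"
    \<comment> \<open>Enlarging the support to \<open>E\<close> adds only the value 0, which the
      adjoined 0 absorbs.\<close>
    have "insert 0 (w z ` (E - \<sigma>)) = insert 0 (w z ` (supp (w z) - \<sigma>))"
      using sub[OF \<open>z \<in> T\<close>] by (auto simp: supp_def)
    then show "max 0 (Min (w z ` \<sigma>) - Max (insert 0 (w z ` (E - \<sigma>)))) = levels (w z) \<sigma>"
      using True by (simp add: levels_def)
  qed
next
  case False
  then have "levels (w z) \<sigma> = 0" for z
    by (auto simp: levels_def)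
  then show ?thesis
    by simp
qed

lemma continuous_on_normalize_weight:
  assumes "\<And>z. z \<in> T \<Longrightarrow> sum (w z) (supp (w z)) \<noteq> 0"
  shows "continuous_on T (\<lambda>z. normalize_weight (w z) a)"
  unfolding normalize_weight_def
  by (intro continuous_on_divide cont continuous_on_total ballI assms)

end

lemma continuous_on_mass:
  assumes "finite E" "\<And>z. z \<in> T \<Longrightarrow> supp (c z) \<subseteq> E" "\<And>\<sigma>. continuous_on T (\<lambda>z. c z \<sigma>)"
  shows "continuous_on T (\<lambda>z. mass (c z) a)"
  unfolding mass_def using assms by (intro continuous_on_sum_supp) auto

lemma continuous_on_kept:
  assumes "finite E" "\<And>z. z \<in> T \<Longrightarrow> supp (w z) \<subseteq> E" "\<And>a. continuous_on T (\<lambda>z. w z a)"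
    and "continuous_on T \<theta>"
  shows "continuous_on T (\<lambda>z. kept (\<theta> z) (w z) a)"
  unfolding kept_def below_def using assms
  by (intro continuous_intros continuous_on_sum_supp) auto

lemma continuous_on_slide:
  assumes "finite E" "\<And>z. z \<in> T \<Longrightarrow> supp (w z) \<subseteq> E" "\<And>a. continuous_on T (\<lambda>z. w z a)"
    and "continuous_on T \<theta>" "continuous_on T u"
  shows "continuous_on T (\<lambda>z. slide f p (u z) (\<theta> z) (w z) a)"
proof -
  have "continuous_on T (\<lambda>z. if a = p then u z else 0)"
    using assms(5) by (cases "a = p") auto
  moreover have "kept \<theta> w a = 0" if "w a = 0" for \<theta> w and a :: 'a
    using that by (simp add: kept_def)
  ultimately show ?thesis
    unfolding slide_def shift_def using assms
    by (intro continuous_intros continuous_on_sum_supp[OF assms(1,2)] continuous_on_kept[OF assms(1,2)]) auto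
qed

text \<open>A relation between two functions avoids the inverse of \<open>g\<close>; since the
  supports lie in \<open>A\<close>, it still determines \<open>w'\<close> from
  \<open>w\<close>.\<close>

definition transported :: "('a \<Rightarrow> 'a) \<Rightarrow> 'a set \<Rightarrow> ('a \<Rightarrow> real) \<Rightarrow> ('a \<Rightarrow> real) \<Rightarrow> bool" where
  "transported g A w w' \<longleftrightarrow>
     bij_betw g A A \<and> supp w \<subseteq> A \<and> supp w' \<subseteq> A \<and> (\<forall>a\<in>A. w' (g a) = w a)"

lemma transported_supp:
  assumes "transported g A w w'"
  shows "supp w' = g ` supp w"
proof (intro subset_antisym subsetI)
  fix b
  assume b: "b \<in> supp w'"
  then have "b \<in> g ` A"
    using assms by (auto simp: transported_def bij_betw_def)
  then obtain a where "a \<in> A" "b = g a"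
    by blast
  then show "b \<in> g ` supp w"
    using assms b by (auto simp: transported_def supp_def)
qed (use assms in \<open>auto simp: transported_def supp_def\<close>)

lemma transported_sum:
  assumes t: "transported g A w w'"
    and Q: "\<And>a. a \<in> supp w \<Longrightarrow> Q' (g a) \<longleftrightarrow> Q a" and v: "\<And>a. a \<in> supp w \<Longrightarrow> v' (g a) = v a"
  shows "(\<Sum>b | b \<in> supp w' \<and> Q' b. v' b) = (\<Sum>a | a \<in> supp w \<and> Q a. v a)"
proof -
  have "{b. b \<in> supp w' \<and> Q' b} = g ` {a. a \<in> supp w \<and> Q a}"
    using Q by (auto simp: transported_supp[OF t])
  moreover have "inj_on g {a. a \<in> supp w \<and> Q a}"
    using t by (auto simp: transported_def bij_betw_def intro: inj_on_subset)
  ultimately show ?thesis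
    using v by (simp add: sum.reindex)
qed

lemma transported_total:
  assumes "transported g A w w'"
  shows "sum w' (supp w') = sum w (supp w)"
  using transported_sum[OF assms, of "\<lambda>_. True" "\<lambda>_. True" w' w] assms
  by (auto simp: transported_def)

lemma transported_normalize_weight:
  assumes "transported g A w w'" "a \<in> A"
  shows "normalize_weight w' (g a) = normalize_weight w a"
  unfolding normalize_weight_def transported_total[OF assms(1)]
  using assms by (simp add: transported_def)

lemma transported_mass:
  assumes c: "c \<in> cone_weights (order_chains A)" and c': "c' \<in> cone_weights (order_chains A)"
    and t: "transported (image g) (order_chains A) c c'" and g: "bij_betw g A A"
  shows "transported g A (mass c) (mass c')"
proof -
  have "mass c' (g a) = mass c a" if a: "a \<in> A" for a
    unfolding mass_def
  proof (rule transported_sum[OF t])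
    fix \<sigma>
    assume "\<sigma> \<in> supp c"
    then have "\<sigma> \<in> order_chains A"
      using c by (auto simp: cone_weights_def)
    then have "\<sigma> \<subseteq> A"
      by (simp add: order_chains_def)
    then show "g a \<in> g ` \<sigma> \<longleftrightarrow> a \<in> \<sigma>"
      using g a by (intro inj_on_image_mem_iff[of g A]) (auto simp: bij_betw_def)
    show "c' (g ` \<sigma>) = c \<sigma>"
      using t \<open>\<sigma> \<in> order_chains A\<close> by (simp add: transported_def)
  qed
  then show ?thesis
    using g mass_cone[OF c] mass_cone[OF c'] by (simp add: transported_def cone_weights_def)
qed

lemma transported_levels:
  assumes t: "transported g A w w'" and \<sigma>: "\<sigma> \<subseteq> A"
  shows "levels w' (g ` \<sigma>) = levels w \<sigma>"
proof -
  have inj: "inj_on g A" and sub: "supp w \<subseteq> A" and eq: "\<And>a. a \<in> A \<Longrightarrow> w' (g a) = w a"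
    using t by (auto simp: transported_def bij_betw_def)
  have image: "w' ` g ` \<tau> = w ` \<tau>" if "\<tau> \<subseteq> A" for \<tau>
    unfolding image_image using that eq by (intro image_cong) auto
  have "supp w' - g ` \<sigma> = g ` (supp w - \<sigma>)"
    unfolding transported_supp[OF t]
    using inj_on_image_set_diff[OF inj, of "supp w" \<sigma>] sub \<sigma> by blast
  then have "w' ` (supp w' - g ` \<sigma>) = w ` (supp w - \<sigma>)"
    using image sub by (simp add: subset_iff)
  moreover have "finite (g ` \<sigma>) \<longleftrightarrow> finite \<sigma>"
    using inj \<sigma> by (intro finite_image_iff) (auto intro: inj_on_subset)
  ultimately show ?thesis
    using image[OF \<sigma>] by (simp add: levels_def)
qed

text \<open>\<open>slide\<close> is built from the order, \<open>f\<close>, \<open>p\<close> and the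
  values of \<open>w\<close> alone, and \<open>g\<close> respects all of them.\<close>

lemma transported_slide:
  assumes t: "transported g A w w'"
    and order: "\<And>a b. a \<in> A \<Longrightarrow> b \<in> A \<Longrightarrow> g a \<le> g b \<longleftrightarrow> a \<le> b"
    and f: "\<And>a. a \<in> A \<Longrightarrow> f a \<in> A" "\<And>a. a \<in> A \<Longrightarrow> f (g a) = g (f a)"
    and p: "p \<in> A" "g p = p"
    and a: "a \<in> A"
  shows "slide f p u \<theta> w' (g a) = slide f p u \<theta> w a"
proof -
  have inj: "inj_on g A" and sub: "supp w \<subseteq> A" and eq: "\<And>a. a \<in> A \<Longrightarrow> w' (g a) = w a"
    using t by (auto simp: transported_def bij_betw_def)
  have "below w' (g b) = below w b" if "b \<in> A" for b
    unfolding below_def using sub that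
    by (intro transported_sum[OF t] eq) (auto simp: less_le_not_le order subset_iff)
  then have kept: "kept \<theta> w' (g b) = kept \<theta> w b" if "b \<in> A" for b
    using that by (simp add: kept_def eq)
  have "(\<Sum>b | b \<in> supp w' \<and> f b = g a. w' b - kept \<theta> w' b) =
      (\<Sum>b | b \<in> supp w \<and> f b = a. w b - kept \<theta> w b)"
  proof (rule transported_sum[OF t])
    fix b
    assume "b \<in> supp w"
    then have "b \<in> A"
      using sub by blast
    then show "f (g b) = g a \<longleftrightarrow> f b = a" "w' (g b) - kept \<theta> w' (g b) = w b - kept \<theta> w b"
      using f a inj eq kept by (auto simp: inj_on_eq_iff)
  qed
  moreover have "g a = p \<longleftrightarrow> a = p"
    using p a inj by (metis inj_on_eq_iff)
  ultimately show ?thesis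
    using kept[OF a] by (simp add: slide_def shift_def)
qed

text \<open>The comparison \<open>a \<le> f a \<ge> p\<close> is turned into an equivariant
  contraction. The poset and the quotient stay abstract so that the fixed points and the orbit space
  are both instances.\<close>

lemma contractible_chain_quotient:
  fixes A :: "'a::order set"
  assumes quot: "nerve_quotient (order_chains A) S \<pi> (image ` \<Gamma>)"
    and f_closed: "\<And>a. a \<in> A \<Longrightarrow> f a \<in> A"
    and f_mono: "\<And>a b. a \<in> A \<Longrightarrow> b \<in> A \<Longrightarrow> a \<le> b \<Longrightarrow> f a \<le> f b"
    and f_increasing: "\<And>a. a \<in> A \<Longrightarrow> a \<le> f a"
    and p: "p \<in> A" "\<And>a. a \<in> A \<Longrightarrow> p \<le> f a"
    and bij: "\<And>g. g \<in> \<Gamma> \<Longrightarrow> bij_betw g A A"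
    and order: "\<And>g a b. g \<in> \<Gamma> \<Longrightarrow> a \<in> A \<Longrightarrow> b \<in> A \<Longrightarrow> g a \<le> g b \<longleftrightarrow> a \<le> b"
    and equivariant: "\<And>g a. g \<in> \<Gamma> \<Longrightarrow> a \<in> A \<Longrightarrow> f (g a) = g (f a)" "\<And>g. g \<in> \<Gamma> \<Longrightarrow> g p = p"
  shows "contractible_sset S"
proof -
  interpret nerve_quotient "order_chains A" S \<pi> "image ` \<Gamma>"
      "simplices (nerve (order_chains A) (\<lambda>a b. b \<le> a))"
    by fact
  \<comment> \<open>Up to \<open>s = 1/2\<close> the threshold falls from the total mass to 0 while
    \<open>u = 0\<close>; afterwards the threshold is 0 and \<open>u\<close> grows to 1. The stages
    do not overlap, as \<open>slide_cone\<close> demands.\<close>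
  define moved where "moved c s =
      slide f p (max 0 (2 * s - 1)) ((1 - min 1 (2 * s)) * sum (mass c) (supp (mass c))) (mass c)"
    for c :: "'a set \<Rightarrow> real" and s :: real
  define h where "h c s = normalize_weight (levels (moved c s))" for c and s :: real
  note slide_cone' = slide_cone[where A = A and f = f and p = p, OF f_closed f_mono f_increasing p]
  have mass: "mass c \<in> cone_weights A" if "c \<in> weights (order_chains A)" for c
    using that weights_cone mass_cone by blast
  have moved: "moved c s \<in> cone_weights A"
    "supp (moved c s) \<subseteq> supp (mass c) \<union> f ` supp (mass c) \<union> {p}"
    if "c \<in> weights (order_chains A)" "s \<in> {0..1}" for c s
    unfolding moved_def using that by (intro slide_cone' mass; simp add: max_def split: if_splits)+
  have levels: "levels (moved c s) \<in> cone_weights (order_chains A)"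
    if "c \<in> weights (order_chains A)" "s \<in> {0..1}" for c s
    using moved(1)[OF that] by (rule levels_cone)
  \<comment> \<open>All chains that occur consist of elements of the chains in \<open>E\<close>,
    their images and \<open>p\<close>: a supply independent of \<open>c\<close> and
    \<open>s\<close>, and finite when \<open>E\<close> is.\<close>
  have supp_h: "supp (h c s) \<subseteq> {\<sigma> \<in> order_chains A. \<sigma> \<subseteq> \<Union>E \<union> f ` \<Union>E \<union> {p}}"
    if E: "E \<subseteq> order_chains A" and c: "c \<in> weights E" and s: "s \<in> {0..1}" for E c s
  proof -
    have c': "c \<in> weights (order_chains A)"
      using weights_mono[OF E] c by blast
    have "supp (mass c) \<subseteq> \<Union>E"
      using supp_mass[OF weights_cone[OF c']] c by (auto simp: weights_def)
    then have "supp (moved c s) \<subseteq> \<Union>E \<union> f ` \<Union>E \<union> {p}"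
      using moved(2)[OF c' s] by blast
    moreover have "supp (h c s) \<subseteq> order_chains A \<inter> Pow (supp (moved c s))"
      unfolding h_def normalize_weight_weights(2)[OF levels[OF c' s]]
      using levels[OF c' s] moved(1)[OF c' s] supp_levels by (auto simp: cone_weights_def)
    ultimately show ?thesis
      by blast
  qed
  have finite_union: "finite (\<Union>E \<union> f ` \<Union>E \<union> {p})" if "finite E" "E \<subseteq> order_chains A" for E
    using that by (auto simp: order_chains_def)
  have "contractible_space (realization S)"
  proof (rule contractible_realization[of h])
    fix c and s :: real
    assume "c \<in> weights (order_chains A)" "s \<in> {0..1}"
    then show "h c s \<in> weights (order_chains A)"
      unfolding h_def by (intro normalize_weight_weights levels)
  next
    fix c c' g and s :: real and d
    assume c: "c \<in> weights (order_chains A)" "c' \<in> weights (order_chains A)"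
      and "g \<in> image ` \<Gamma>" and eq: "\<And>d. d \<in> order_chains A \<Longrightarrow> c' (g d) = c d"
      and s: "s \<in> {0..1}" and d: "d \<in> order_chains A"
    then obtain \<gamma> where \<gamma>: "\<gamma> \<in> \<Gamma>" "g = image \<gamma>"
      by blast
    have bij_g: "bij_betw g (order_chains A) (order_chains A)"
      using \<open>g \<in> image ` \<Gamma>\<close> by (rule bij_Gamma)
    then have "transported (image \<gamma>) (order_chains A) c c'"
      using eq c \<gamma>(2) by (auto simp: transported_def weights_def)
    then have t: "transported \<gamma> A (mass c) (mass c')"
      using c bij[OF \<gamma>(1)] by (intro transported_mass weights_cone)
    have "moved c' s (\<gamma> a) = moved c s a" if "a \<in> A" for a
      unfolding moved_def transported_total[OF t]
      by (rule transported_slide[OF t]) (use that \<gamma>(1) order equivariant f_closed p in auto)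
    then have t': "transported \<gamma> A (moved c s) (moved c' s)"
      using bij[OF \<gamma>(1)] moved(1)[OF c(1) s] moved(1)[OF c(2) s]
      by (simp add: transported_def cone_weights_def)
    have "transported g (order_chains A) (levels (moved c s)) (levels (moved c' s))"
      using bij_g transported_levels[OF t'] levels[OF c(1) s] levels[OF c(2) s] \<gamma>(2)
      by (auto simp: transported_def cone_weights_def order_chains_def)
    then show "h c' s (g d) = h c s d"
      unfolding h_def using d by (rule transported_normalize_weight)
  next
    fix E
    assume E: "finite E" "E \<subseteq> order_chains A"
    then show "\<exists>F. finite F \<and> F \<subseteq> order_chains A \<and> (\<forall>c\<in>weights E. \<forall>s\<in>{0..1}. supp (h c s) \<subseteq> F)"
      using supp_h[OF E(2)] finite_union[OF E]
      by (intro exI[of _ "{\<sigma> \<in> order_chains A. \<sigma> \<subseteq> \<Union>E \<union> f ` \<Union>E \<union> {p}}"]) auto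
    let ?T = "{0..1::real} \<times> weights E"
    let ?B = "\<Union>E \<union> f ` \<Union>E \<union> {p}"
    have c: "c \<in> weights (order_chains A)" if "c \<in> weights E" for c
      using weights_mono[OF E(2)] that by blast
    have supp_mass_E: "supp (mass (snd z)) \<subseteq> \<Union>E" if "z \<in> ?T" for z
    proof -
      have "snd z \<in> weights E"
        using that by auto
      then show ?thesis
        using supp_mass[OF weights_cone[OF c[of "snd z"]]] by (auto simp: weights_def)
    qed
    have supp_moved: "supp (moved (snd z) (fst z)) \<subseteq> ?B" if "z \<in> ?T" for z
    proof -
      have "snd z \<in> weights E" "fst z \<in> {0..1}"
        using that by auto
      then show ?thesis
        using moved(2)[OF c, of "snd z" "fst z"] supp_mass_E[OF that] by blast
    qed
    have "continuous_on ?T (\<lambda>z. snd z \<sigma>)" for \<sigma> :: "'a set"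
      by (rule continuous_on_product_then_coordinatewise) (intro continuous_intros)
    then have cont_mass: "continuous_on ?T (\<lambda>z. mass (snd z) a)" for a
      using E(1) by (intro continuous_on_mass) (auto simp: weights_def)
    have cont_moved: "continuous_on ?T (\<lambda>z. moved (snd z) (fst z) a)" for a
      unfolding moved_def
      by (intro continuous_on_slide[where E = "\<Union>E"] continuous_on_total[where E = "\<Union>E"]
          continuous_intros cont_mass supp_mass_E) (use finite_union[OF E] in auto)
    have cont_levels: "continuous_on ?T (\<lambda>z. levels (moved (snd z) (fst z)) \<sigma>)" for \<sigma>
      using moved(1)[OF c]
      by (intro continuous_on_levels[where E = ?B] finite_union[OF E] cont_moved supp_moved)
        (auto simp: cone_weights_def)
    have "continuous_on ?T (\<lambda>z. h (snd z) (fst z) \<sigma>)" for \<sigma>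
      unfolding h_def
    proof (rule continuous_on_normalize_weight[OF _ _ cont_levels])
      show "finite (Pow ?B)"
        using finite_union[OF E] by simp
      show "supp (levels (moved (snd z) (fst z))) \<subseteq> Pow ?B" if "z \<in> ?T" for z
        using supp_levels[of "moved (snd z) (fst z)"] supp_moved[OF that]
          finite_subset[OF supp_moved[OF that] finite_union[OF E]] by blast
      show "sum (levels (moved (snd z) (fst z))) (supp (levels (moved (snd z) (fst z)))) \<noteq> 0"
        if "z \<in> ?T" for z
        using that sum_supp_pos[OF levels[OF c, of "snd z" "fst z"]] by fastforce
    qed
    then show "continuous_on ?T (\<lambda>(s, c). h c s)"
      unfolding case_prod_unfold by (rule continuous_on_coordinatewise_then_product)
  next
    fix c
    assume c: "c \<in> weights (order_chains A)"
    have "moved c 0 = mass c"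
      using slide_start[OF mass[OF c], of f p] by (simp add: moved_def)
    then show "h c 0 = c"
      using levels_mass[OF weights_cone[OF c]] normalize_weight_id[OF c] by (simp add: h_def)
    \<comment> \<open>At the end the factor \<open>1 - u\<close> is 0 and \<open>c\<close> is
      forgotten; the common endpoint is the vertex \<open>{p}\<close>.\<close>
    have "moved c 1 = (\<lambda>b. if b = p then 1 else 0)"
      by (rule ext) (simp add: moved_def slide_def)
    then show "h c 1 = normalize_weight (levels (\<lambda>b. if b = p then 1 else 0))"
      by (simp add: h_def)
  qed
  moreover have "{p} \<in> order_chains A"
    using p by (simp add: order_chains_def comparable_def)
  ultimately show ?thesis
    using topspace_realization_nonempty by (auto simp: contractible_sset_def)
qed

section \<open>Subgroups normalized by P\<close>

text \<open>A least moved point \<open>m\<close> is contradictory: if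
  \<open>\<phi> m \<le> m\<close>, then \<open>\<phi> m\<close> is fixed and injectivity gives
  \<open>\<phi> m = m\<close>; otherwise the preimage of \<open>m\<close> lies above
  \<open>m\<close>, and monotonicity forces \<open>\<phi> m \<le> m\<close> after all.\<close>

lemma fixed_comparable:
  fixes \<phi> :: "'a::order \<Rightarrow> 'a"
  assumes "finite \<sigma>" "comparable \<sigma>" and image: "\<phi> ` \<sigma> = \<sigma>"
    and mono: "\<And>x y. x \<in> \<sigma> \<Longrightarrow> y \<in> \<sigma> \<Longrightarrow> x \<le> y \<Longrightarrow> \<phi> x \<le> \<phi> y"
    and "x \<in> \<sigma>"
  shows "\<phi> x = x"
proof (rule ccontr)
  assume "\<phi> x \<noteq> x"
  have inj: "inj_on \<phi> \<sigma>"
    using assms(1) image by (simp add: eq_card_imp_inj_on)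
  have "{y \<in> \<sigma>. \<phi> y \<noteq> y} \<noteq> {}" "finite {y \<in> \<sigma>. \<phi> y \<noteq> y}"
    using \<open>\<phi> x \<noteq> x\<close> assms(1,5) by auto
  then obtain m where m: "m \<in> \<sigma>" "\<phi> m \<noteq> m"
    and minimal: "\<And>y. y \<in> \<sigma> \<Longrightarrow> \<phi> y \<noteq> y \<Longrightarrow> y \<le> m \<Longrightarrow> y = m"
    using finite_has_minimal[of "{y \<in> \<sigma>. \<phi> y \<noteq> y}"] by auto
  obtain n where n: "n \<in> \<sigma>" "m = \<phi> n"
    using m(1) image by blast
  have m': "\<phi> m \<in> \<sigma>"
    using m(1) image by blast
  show False
  proof (cases "\<phi> m \<le> m")
    case True
    then have "\<phi> (\<phi> m) = \<phi> m"
      using minimal[OF m'] m by auto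
    then show False
      using inj m m' by (auto simp: inj_on_eq_iff)
  next
    case False
    moreover have "\<not> n \<le> m"
      using minimal[OF n(1)] n(2) m(2) by metis
    then have "m \<le> n"
      using assms(2) m(1) n(1) unfolding comparable_def by blast
    then have "\<phi> m \<le> m"
      using mono[OF m(1) n(1)] n(2) by simp
    ultimately show False
      by simp
  qed
qed

lemma bij_betw_order_chains:
  fixes g :: "'a::order \<Rightarrow> 'a"
  assumes bij: "bij_betw g A A"
    and order: "\<And>a b. a \<in> A \<Longrightarrow> b \<in> A \<Longrightarrow> g a \<le> g b \<longleftrightarrow> a \<le> b"
  shows "bij_betw (image g) (order_chains A) (order_chains A)"
proof -
  have iff: "g ` \<sigma> \<in> order_chains A \<longleftrightarrow> \<sigma> \<in> order_chains A" if "\<sigma> \<subseteq> A" for \<sigma>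
  proof -
    have "comparable (g ` \<sigma>) \<longleftrightarrow> comparable \<sigma>"
      using order that by (auto simp: comparable_def subset_iff)
    moreover have "finite (g ` \<sigma>) \<longleftrightarrow> finite \<sigma>"
      using bij that by (intro finite_image_iff) (auto simp: bij_betw_def intro: inj_on_subset)
    moreover have "g ` \<sigma> \<subseteq> A"
      using bij that by (auto simp: bij_betw_def)
    ultimately show ?thesis
      using that by (auto simp: order_chains_def)
  qed
  have "inj_on (image g) (order_chains A)"
    using inj_on_image_eq_iff[of g A] bij by (auto simp: inj_on_def order_chains_def bij_betw_def)
  moreover have "image g ` order_chains A = order_chains A"
  proof (intro subset_antisym subsetI)
    fix \<tau>
    assume \<tau>: "\<tau> \<in> order_chains A"
    then have "\<tau> \<subseteq> g ` A"
      using bij by (auto simp: order_chains_def bij_betw_def)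
    then obtain \<sigma> where "\<sigma> \<subseteq> A" "\<tau> = g ` \<sigma>"
      by (auto simp: subset_image_iff)
    then show "\<tau> \<in> image g ` order_chains A"
      using iff \<tau> by auto
  qed (use iff in \<open>auto simp: order_chains_def\<close>)
  ultimately show ?thesis
    by (simp add: bij_betw_def)
qed

lemma subgroup_chains_eq: "subgroup_chains \<C> = order_chains \<C>"
  by (auto simp: subgroup_chains_def order_chains_def comparable_def chain_subset_def)

section \<open>Conjugation and products of subgroups\<close>

context group
begin

lemma conjugate_eq: "conjugate G g H = (\<lambda>h. g \<otimes> h \<otimes> inv g) ` H"
  unfolding conjugate_def l_coset_def r_coset_def by blast

lemma conjugate_mono: "H \<subseteq> K \<Longrightarrow> conjugate G g H \<subseteq> conjugate G g K"
  unfolding conjugate_eq by (rule image_mono)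

lemma conjugate_mult:
  assumes "g \<in> carrier G" "h \<in> carrier G" "H \<subseteq> carrier G"
  shows "conjugate G g (conjugate G h H) = conjugate G (g \<otimes> h) H"
  unfolding conjugate_eq image_image
  by (rule image_cong) (use assms in \<open>auto simp: m_assoc inv_mult_group subset_iff\<close>)

lemma conjugate_one: "H \<subseteq> carrier G \<Longrightarrow> conjugate G \<one> H = H"
  unfolding conjugate_eq by (force simp: subset_iff image_iff)

lemma conjugate_inv:
  assumes "g \<in> carrier G" "H \<subseteq> carrier G"
  shows "conjugate G (inv g) (conjugate G g H) = H" "conjugate G g (conjugate G (inv g) H) = H"
  using assms by (simp_all add: conjugate_mult conjugate_one)

lemma conjugate_subset_iff:
  assumes "g \<in> carrier G" "H \<subseteq> carrier G" "K \<subseteq> carrier G"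
  shows "conjugate G g H \<subseteq> conjugate G g K \<longleftrightarrow> H \<subseteq> K"
  using conjugate_mono conjugate_inv(1)[OF assms(1)] assms(2,3) by metis

lemma conjugate_set_mult:
  assumes g: "g \<in> carrier G" and H: "H \<subseteq> carrier G" and K: "K \<subseteq> carrier G"
  shows "conjugate G g (H <#> K) = conjugate G g H <#> conjugate G g K"
proof -
  have "g \<otimes> (h \<otimes> k) \<otimes> inv g = (g \<otimes> h \<otimes> inv g) \<otimes> (g \<otimes> k \<otimes> inv g)" if "h \<in> H" "k \<in> K" for h k
  proof -
    have "h \<in> carrier G" "k \<in> carrier G"
      using that H K by auto
    then have "inv g \<otimes> (g \<otimes> (k \<otimes> inv g)) = k \<otimes> inv g"
      using g by (simp add: m_assoc[symmetric])
    then show ?thesis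
      using g \<open>h \<in> carrier G\<close> \<open>k \<in> carrier G\<close> by (simp add: m_assoc)
  qed
  then show ?thesis
    unfolding conjugate_eq set_mult_def by (force simp: image_iff)
qed

text \<open>Conjugation by \<open>inv p\<close> also maps \<open>P\<close> into itself, which gives
  the reverse inclusion.\<close>

lemma conjugate_self:
  assumes "subgroup P G" "p \<in> P"
  shows "conjugate G p P = P"
proof -
  interpret P: subgroup P G
    by fact
  have sub: "conjugate G q P \<subseteq> P" if "q \<in> P" for q
    using that by (auto simp: conjugate_eq)
  have "P = conjugate G p (conjugate G (inv p) P)"
    using assms P.subset by (simp add: conjugate_inv subset_iff)
  also have "\<dots> \<subseteq> conjugate G p P"
    using sub assms by (intro conjugate_mono) auto
  finally show ?thesis
    using sub[OF assms(2)] by blast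
qed

lemma subgroup_set_mult_normalized:
  assumes P: "subgroup P G" and H: "subgroup H G"
    and normalized: "\<And>p. p \<in> P \<Longrightarrow> conjugate G p H = H"
  shows "subgroup (P <#> H) G"
proof -
  interpret P: subgroup P G by fact
  interpret H: subgroup H G by fact
  have conj: "inv p \<otimes> h \<otimes> p \<in> H" if "p \<in> P" "h \<in> H" for p h
  proof -
    have "inv p \<otimes> h \<otimes> inv (inv p) \<in> conjugate G (inv p) H"
      using that by (auto simp: conjugate_eq)
    then show ?thesis
      using normalized[of "inv p"] that by simp
  qed
  show ?thesis
  proof
    show "P <#> H \<subseteq> carrier G"
      by (intro set_mult_closed P.subset H.subset)
    have "\<one> \<otimes> \<one> \<in> P <#> H"
      unfolding set_mult_def using P.one_closed H.one_closed by blast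
    then show "\<one> \<in> P <#> H"
      by simp
  next
    fix x y
    assume "x \<in> P <#> H" "y \<in> P <#> H"
    then obtain p h q k where xy: "x = p \<otimes> h" "y = q \<otimes> k" "p \<in> P" "h \<in> H" "q \<in> P" "k \<in> H"
      unfolding set_mult_def by blast
    \<comment> \<open>The factors from \<open>P\<close> are collected on the left: (p h)(q k) = (p
      q)((q^-1 h q) k).\<close>
    then have "q \<otimes> (inv q \<otimes> (h \<otimes> (q \<otimes> k))) = h \<otimes> (q \<otimes> k)"
      by (simp add: m_assoc[symmetric])
    then have "x \<otimes> y = (p \<otimes> q) \<otimes> ((inv q \<otimes> h \<otimes> q) \<otimes> k)"
      using xy by (simp add: m_assoc)
    moreover have "p \<otimes> q \<in> P" "(inv q \<otimes> h \<otimes> q) \<otimes> k \<in> H"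
      using xy conj by auto
    ultimately show "x \<otimes> y \<in> P <#> H"
      unfolding set_mult_def by blast
  next
    fix x
    assume "x \<in> P <#> H"
    then obtain p h where x: "x = p \<otimes> h" "p \<in> P" "h \<in> H"
      unfolding set_mult_def by blast
    \<comment> \<open>\<open>inv (inv p)\<close> is left unsimplified so that the second factor has
      the shape of \<open>conj\<close>, with \<open>inv p\<close> in place of
      \<open>p\<close>.\<close>
    then have "inv x = inv p \<otimes> (inv (inv p) \<otimes> inv h \<otimes> inv p)"
      by (simp add: inv_mult_group m_assoc[symmetric])
    moreover have "inv p \<in> P" "inv (inv p) \<otimes> inv h \<otimes> inv p \<in> H"
      using x conj[of "inv p" "inv h"] by auto
    ultimately show "inv x \<in> P <#> H"
      unfolding set_mult_def by blast
  qed
qed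

end

definition normalized_by :: "('g, 'z) monoid_scheme \<Rightarrow> 'g set set \<Rightarrow> 'g set \<Rightarrow> 'g set set" where
  "normalized_by G \<C> P = {H \<in> \<C>. \<forall>p\<in>P. conjugate G p H = H}"

text \<open>Conjugation by \<open>p\<close> is monotone, so if it preserves a finite chain as a set
  it fixes each member, by \<open>fixed_comparable\<close>.\<close>

lemma simplices_fixed_dwyer_space:
  assumes G: "group G" and \<C>: "collection G \<C>" and P: "P \<subseteq> carrier G"
  shows "simplices (fixed_sset P (dwyer_action G) (dwyer_space \<C>)) n =
    simplices (nerve (order_chains (normalized_by G \<C> P)) (\<lambda>\<sigma> \<tau>. \<tau> \<subseteq> \<sigma>)) n"
proof -
  have "(\<forall>p\<in>P. image (conjugate G p) \<sigma> = \<sigma>) \<longleftrightarrow> \<sigma> \<subseteq> normalized_by G \<C> P"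
    if \<sigma>: "\<sigma> \<in> order_chains \<C>" for \<sigma>
  proof
    assume fixed: "\<forall>p\<in>P. image (conjugate G p) \<sigma> = \<sigma>"
    show "\<sigma> \<subseteq> normalized_by G \<C> P"
    proof
      fix H
      assume "H \<in> \<sigma>"
      then have "conjugate G p H = H" if "p \<in> P" for p
        using fixed that \<sigma> group.conjugate_mono[OF G]
        by (intro fixed_comparable[of \<sigma>]) (auto simp: order_chains_def)
      then show "H \<in> normalized_by G \<C> P"
        using \<open>H \<in> \<sigma>\<close> \<sigma> by (auto simp: normalized_by_def order_chains_def)
    qed
  next
    assume "\<sigma> \<subseteq> normalized_by G \<C> P"
    then have "conjugate G p H = H" if "p \<in> P" "H \<in> \<sigma>" for p H
      using that by (auto simp: normalized_by_def)
    then show "\<forall>p\<in>P. image (conjugate G p) \<sigma> = \<sigma>"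
      by simp
  qed
  moreover have "normalized_by G \<C> P \<subseteq> \<C>"
    by (auto simp: normalized_by_def)
  then have "\<sigma> \<in> order_chains (normalized_by G \<C> P) \<longleftrightarrow>
      \<sigma> \<in> order_chains \<C> \<and> \<sigma> \<subseteq> normalized_by G \<C> P" for \<sigma>
    unfolding order_chains_def by blast
  ultimately have "\<sigma> \<in> order_chains \<C> \<and> (\<forall>p\<in>P. image (conjugate G p) \<sigma> = \<sigma>) \<longleftrightarrow>
      \<sigma> \<in> order_chains (normalized_by G \<C> P)" for \<sigma>
    by metis
  then have "order_chains (normalized_by G \<C> P) =
      {\<sigma> \<in> order_chains \<C>. \<forall>p\<in>P. image (conjugate G p) \<sigma> = \<sigma>}"
    by blast
  moreover have "dwyer_action G p xs = xs \<longleftrightarrow> (\<forall>\<sigma>\<in>set xs. image (conjugate G p) \<sigma> = \<sigma>)" for p xs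
    using map_eq_conv[of "image (conjugate G p)" xs id] by (simp add: dwyer_action_def)
  ultimately have "set xs \<subseteq> order_chains (normalized_by G \<C> P) \<longleftrightarrow>
      set xs \<subseteq> order_chains \<C> \<and> (\<forall>p\<in>P. dwyer_action G p xs = xs)" for xs
    by (simp only:) blast
  then show ?thesis
    by (simp add: fixed_sset_def dwyer_space_def nerve_def subgroup_chains_eq conj_ac)
qed

theorem proposition6p12:
  fixes G :: "('g, 'z) monoid_scheme" and \<C> :: "'g set set" and P :: "'g set"
  assumes "group G" and "collection G \<C>" and "closed_under_products G \<C>" and "P \<in> \<C>"
  shows "contractible_sset (fixed_sset P (dwyer_action G) (dwyer_space \<C>)) \<and>
    contractible_sset
      (orbit_sset (G\<lparr>carrier := centralizer G P\<rparr>) (dwyer_action G)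
        (fixed_sset P (dwyer_action G) (dwyer_space \<C>)))"
proof -
  interpret group G
    by fact
  interpret X: simplicial_G_set G "dwyer_space \<C>" "dwyer_action G"
    using assms(1,2) by (rule simplicial_G_set_dwyer_space)
  define A where "A = normalized_by G \<C> P"
  define F where "F = fixed_sset P (dwyer_action G) (dwyer_space \<C>)"
  define Z where "Z = centralizer G P"
  have subgr: "subgroup H G" if "H \<in> \<C>" for H
    using assms(2) that by (simp add: collection_def)
  then have sub: "H \<subseteq> carrier G" if "H \<in> \<C>" for H
    using that by (simp add: subgroup.subset)
  have P: "subgroup P G" "P \<subseteq> carrier G"
    using subgr sub assms(4) by auto
  interpret Y: simplicial_G_set "G\<lparr>carrier := Z\<rparr>" F "dwyer_action G"
    unfolding F_def Z_def using P(2) by (rule X.simplicial_G_set_fixed_sset)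
  have F_simplices: "simplices F n = simplices (nerve (order_chains A) (\<lambda>\<sigma> \<tau>. \<tau> \<subseteq> \<sigma>)) n" for n
    unfolding F_def A_def by (rule simplices_fixed_dwyer_space[OF assms(1,2) P(2)])
  have F_oper: "oper F m n \<alpha> x = map (\<lambda>i. x ! \<alpha> i) [0..<Suc m]" for m n \<alpha> x
    by (simp add: F_def fixed_sset_def dwyer_space_def nerve_def)

  let ?f = "\<lambda>H. P <#>\<^bsub>G\<^esub> H"
  have A: "H \<in> \<C>" "subgroup H G" "H \<subseteq> carrier G" if "H \<in> A" for H
    using that subgr sub by (auto simp: A_def normalized_by_def)
  have normalized: "conjugate G p H = H" if "H \<in> A" "p \<in> P" for H p
    using that by (simp add: A_def normalized_by_def)
  have P_A: "P \<in> A"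
    using assms(4) conjugate_self[OF P(1)] by (simp add: A_def normalized_by_def)
  \<comment> \<open>Closure under products applies because \<open>P\<close> normalizes
    \<open>H\<close>, which makes the product a subgroup. Conjugation by \<open>p\<close> in
    \<open>P\<close> preserves both factors, hence the product.\<close>
  have f_closed: "?f H \<in> A" if "H \<in> A" for H
  proof -
    have "P <#>\<^bsub>G\<^esub> H \<in> \<C>"
      using subgroup_set_mult_normalized[OF P(1) A(2)[OF that] normalized[OF that]]
        assms(3,4) A(1)[OF that] by (simp add: closed_under_products_def)
    moreover have "conjugate G p (P <#>\<^bsub>G\<^esub> H) = P <#>\<^bsub>G\<^esub> H" if "p \<in> P" for p
      using that P A(3)[OF \<open>H \<in> A\<close>] normalized[OF \<open>H \<in> A\<close>] conjugate_self[OF P(1)]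
      by (subst conjugate_set_mult) auto
    ultimately show ?thesis
      by (simp add: A_def normalized_by_def)
  qed
  have f_mono: "?f H \<subseteq> ?f K" if "H \<subseteq> K" for H K
    using that by (intro mono_set_mult) auto
  have f_upper: "H \<subseteq> ?f H" "P \<subseteq> ?f H" if "H \<in> A" for H
  proof -
    have one: "\<one>\<^bsub>G\<^esub> \<in> P" "\<one>\<^bsub>G\<^esub> \<in> H"
      using P(1) A(2)[OF that] by (auto intro: subgroup.one_closed)
    have "\<one>\<^bsub>G\<^esub> \<otimes>\<^bsub>G\<^esub> h \<in> ?f H" if "h \<in> H" for h
      unfolding set_mult_def using one that by blast
    then show "H \<subseteq> ?f H"
      using A(3)[OF that] by (auto simp: subset_iff)
    have "p \<otimes>\<^bsub>G\<^esub> \<one>\<^bsub>G\<^esub> \<in> ?f H" if "p \<in> P" for p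
      unfolding set_mult_def using one that by blast
    then show "P \<subseteq> ?f H"
      using P(2) by (auto simp: subset_iff)
  qed

  have Z: "g \<in> carrier G" "inv\<^bsub>G\<^esub> g \<in> Z" "conjugate G g P = P" if "g \<in> Z" for g
  proof -
    show g: "g \<in> carrier G"
      using that by (simp add: Z_def centralizer_def)
    show "inv\<^bsub>G\<^esub> g \<in> Z"
      using that subgroup.m_inv_closed[OF X.subgroup_centralizer[OF P(2)]] by (simp add: Z_def)
    have "g \<otimes>\<^bsub>G\<^esub> p \<otimes>\<^bsub>G\<^esub> inv\<^bsub>G\<^esub> g = p" if "p \<in> P" for p
      using that \<open>g \<in> Z\<close> g P(2) by (auto simp: Z_def centralizer_def m_assoc)
    then show "conjugate G g P = P"
      by (simp add: conjugate_eq)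
  qed
  \<comment> \<open>An element of the centralizer commutes with every \<open>p\<close> in
    \<open>P\<close>, so the two conjugations commute and being normalized by \<open>P\<close> is
    preserved.\<close>
  have Z_closed: "conjugate G g H \<in> A" if "g \<in> Z" "H \<in> A" for g H
  proof -
    have "conjugate G p (conjugate G g H) = conjugate G g H" if "p \<in> P" for p
    proof -
      have "p \<otimes>\<^bsub>G\<^esub> g = g \<otimes>\<^bsub>G\<^esub> p" "p \<in> carrier G"
        using that P(2) \<open>g \<in> Z\<close> by (auto simp: Z_def centralizer_def)
      then have "conjugate G p (conjugate G g H) = conjugate G g (conjugate G p H)"
        using Z(1)[OF \<open>g \<in> Z\<close>] A(3)[OF \<open>H \<in> A\<close>] by (simp add: conjugate_mult)
      then show ?thesis
        using normalized[OF \<open>H \<in> A\<close> that] by simp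
    qed
    moreover have "conjugate G g H \<in> \<C>"
      using assms(2) Z(1)[OF that(1)] A(1)[OF that(2)] by (simp add: collection_def)
    ultimately show ?thesis
      by (simp add: A_def normalized_by_def)
  qed
  have Z_bij: "bij_betw (conjugate G g) A A" if "g \<in> Z" for g
    using conjugate_inv[OF Z(1)[OF that] A(3)] Z_closed[OF that] Z_closed[OF Z(2)[OF that]]
    by (intro bij_betw_byWitness[where f' = "conjugate G (inv\<^bsub>G\<^esub> g)"]) auto
  have Z_order: "conjugate G g H \<subseteq> conjugate G g K \<longleftrightarrow> H \<subseteq> K" if "g \<in> Z" "H \<in> A" "K \<in> A" for g H K
    using that Z(1) A(3) by (intro conjugate_subset_iff)
  have Z_f: "?f (conjugate G g H) = conjugate G g (?f H)" if "g \<in> Z" "H \<in> A" for g H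
    using conjugate_set_mult[OF Z(1)[OF that(1)] P(2) A(3)[OF that(2)]] Z(3)[OF that(1)] by simp

  \<comment> \<open>The fixed-point space is the trivial quotient, with the identity as its only
    symmetry.\<close>
  have "nerve_quotient (order_chains A) F id (image ` {id})"
    by unfold_locales (simp_all add: F_simplices F_oper)
  then have 1: "contractible_sset F"
    by (rule contractible_chain_quotient[where f = ?f and p = P])
      (use f_closed f_mono f_upper P_A in auto)

  let ?K = "G\<lparr>carrier := Z\<rparr>"
  let ?orb = "orbit ?K (dwyer_action G)"
  have orbit_act: "?orb (dwyer_action G g x) = ?orb x" if g: "g \<in> Z" and x: "x \<in> simplices F n" for g x n
  proof -
    have orbit: "?orb y = (\<lambda>h. dwyer_action G h y) ` Z" for y
      by (auto simp: orbit_def)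
    have shift: "dwyer_action G h (dwyer_action G g x) = dwyer_action G (h \<otimes>\<^bsub>G\<^esub> g) x" if "h \<in> Z" for h
      using Y.act_mult[of h g x n] that g x by simp
    \<comment> \<open>Right multiplication by \<open>g\<close> permutes the centralizer:
      \<open>h\<close> is the translate of \<open>h\<close> times the inverse of
      \<open>g\<close>.\<close>
    have "h \<otimes>\<^bsub>G\<^esub> inv\<^bsub>G\<^esub> g \<in> Z \<and> h \<otimes>\<^bsub>G\<^esub> inv\<^bsub>G\<^esub> g \<otimes>\<^bsub>G\<^esub> g = h" if "h \<in> Z" for h
      using Y.m_closed[of h "inv\<^bsub>G\<^esub> g"] that g Z(1,2) by (simp add: m_assoc)
    then have "h \<in> (\<lambda>h. h \<otimes>\<^bsub>G\<^esub> g) ` Z" if "h \<in> Z" for h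
      using that by (metis image_eqI)
    moreover have "h \<otimes>\<^bsub>G\<^esub> g \<in> Z" if "h \<in> Z" for h
      using Y.m_closed[of h g] that g by simp
    ultimately have "(\<lambda>h. h \<otimes>\<^bsub>G\<^esub> g) ` Z = Z"
      by blast
    moreover have "?orb (dwyer_action G g x) = (\<lambda>h. dwyer_action G h x) ` (\<lambda>h. h \<otimes>\<^bsub>G\<^esub> g) ` Z"
      unfolding orbit image_image using shift by (rule image_cong[OF refl])
    ultimately show ?thesis
      by (simp only: orbit)
  qed
  have "nerve_quotient (order_chains A) (orbit_sset ?K (dwyer_action G) F) ?orb
      (image ` (conjugate G ` Z))"
  proof
    fix n
    show "simplices (orbit_sset ?K (dwyer_action G) F) n =
        ?orb ` simplices (nerve (order_chains A) (\<lambda>\<sigma> \<tau>. \<tau> \<subseteq> \<sigma>)) n"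
      by (auto simp: orbit_sset_def orbits_def F_simplices)
  next
    fix \<alpha> m n x
    assume "\<alpha> \<in> delta_maps m n" "x \<in> simplices (nerve (order_chains A) (\<lambda>\<sigma> \<tau>. \<tau> \<subseteq> \<sigma>)) n"
    then show "oper (orbit_sset ?K (dwyer_action G) F) m n \<alpha> (?orb x) =
        ?orb (map (\<lambda>i. x ! \<alpha> i) [0..<Suc m])"
      using Y.oper_image_orbit[of \<alpha> m n x] by (simp add: orbit_sset_def F_simplices F_oper)
  next
    fix x y n
    assume *: "x \<in> simplices (nerve (order_chains A) (\<lambda>\<sigma> \<tau>. \<tau> \<subseteq> \<sigma>)) n"
      "y \<in> simplices (nerve (order_chains A) (\<lambda>\<sigma> \<tau>. \<tau> \<subseteq> \<sigma>)) n" "?orb x = ?orb y"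
    \<comment> \<open>\<open>y\<close> lies in its own orbit, hence in that of \<open>x\<close>; the
      group element so obtained moves all entries at once.\<close>
    then have "y = dwyer_action G \<one>\<^bsub>G\<^esub> y" "\<one>\<^bsub>G\<^esub> \<in> Z"
      using Y.act_one[of y n] Y.one_closed by (simp_all add: F_simplices)
    then have "y \<in> ?orb x"
      unfolding *(3) by (auto simp: orbit_def)
    then show "\<exists>g\<in>image ` (conjugate G ` Z). y = map g x"
      by (auto simp: orbit_def dwyer_action_def)
  next
    fix g x n
    assume "g \<in> image ` (conjugate G ` Z)" "x \<in> simplices (nerve (order_chains A) (\<lambda>\<sigma> \<tau>. \<tau> \<subseteq> \<sigma>)) n"
    then obtain z where z: "z \<in> Z" "map g x = dwyer_action G z x" and x: "x \<in> simplices F n"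
      by (auto simp: dwyer_action_def F_simplices)
    show "map g x \<in> simplices (nerve (order_chains A) (\<lambda>\<sigma> \<tau>. \<tau> \<subseteq> \<sigma>)) n \<and> ?orb (map g x) = ?orb x"
      using Y.act_closed[of z x n] orbit_act[OF z(1) x] z x by (simp add: F_simplices)
  next
    fix g
    assume "g \<in> image ` (conjugate G ` Z)"
    then show "bij_betw g (order_chains A) (order_chains A)"
      using bij_betw_order_chains[OF Z_bij Z_order] by auto
  qed
  then have "contractible_sset (orbit_sset ?K (dwyer_action G) F)"
  proof (rule contractible_chain_quotient[where f = ?f and p = P])
    show "g H \<subseteq> g K \<longleftrightarrow> H \<subseteq> K" if "g \<in> conjugate G ` Z" "H \<in> A" "K \<in> A" for g H K
      using Z_order that by blast
  qed (use f_closed f_mono f_upper P_A Z_bij Z_f Z(3) in auto)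
  with 1 show ?thesis
    by (simp add: F_def Z_def)
qed

end
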